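(* Let $d\in\mathbb{N}$, $\alpha\in(0,1)$, $\beta\in(0,2)$, and let the spectral measure $\nu$ satisfy the standing assumption stated in the context. Let $f:[0,\infty)\to[0,\infty)$ be locally Lipschitz continuous and non-decreasing, with $f(0)=0$ and $f>0$ on $(0,\infty)$, and of Osgood-type with exponent $k$ for some $k>1+\frac{\beta}{\alpha d}$. Then there exists a non-negative function $u_0\in L_1(\mathbb{R}^d)$ such that there is no local integral solution $u$ of $$\partial_t^{\alpha}(u-u_0)+\Psi_\beta(-i\nabla)u=f(u),\quad t>0,\ x\in\mathbb{R}^d,$$ that remains in $L_1(\mathbb{R}^d)$ for all $t>0$; that is, for no $T>0$ is there an integral solution $u:[0,T)\times\mathbb{R}^d\to[0,\infty]$ with $u(t,\cdot)\in L_1(\mathbb{R}^d)$ for all $t\in(0,T)$.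
   Context: Notation: $g_\rho(t)=\frac{1}{\Gamma(\rho)}t^{\rho-1}$ for $\rho>0$, $t>0$; $\partial_t^\alpha v=\frac{d}{dt}\int_0^t g_{1-\alpha}(t-s)v(s)\,ds$ is the Riemann–Liouville derivative. $\Psi_\beta(-i\nabla)$ is the pseudo-differential operator with symbol $\psi_\beta(\xi)=|\xi|^\beta\omega_\nu(\xi/|\xi|)$, where $\omega_\nu(\theta)=\int_{\mathbb{S}^{d-1}}|\theta\cdot\eta|^\beta\,\nu(d\eta)$ for $\theta\in\mathbb{S}^{d-1}$ and $\nu$ is a (spectral) measure on $\mathbb{S}^{d-1}$. Standing assumption on $\nu$: $\nu$ has a strictly positive density, such that $\omega_\nu$ is strictly positive and $(d+1+[\beta])$-times continuously differentiable on $\mathbb{S}^{d-1}$, where $[\beta]$ is the integer part of $\beta$. Kernels: $G(t,x)=(2\pi)^{-d}\int_{\mathbb{R}^d}e^{ix\cdot\xi}e^{-t\psi_\beta(\xi)}\,d\xi$ is the Green function of $\partial_t v+\Psi_\beta(-i\nabla)v=0$ with $G(0,\cdot)=\delta_0$. $G_\alpha(t,s)$ is the Green function of $\partial_t v(t,s)+\frac{d^\alpha}{ds^\alpha}v(t,s)=0$ with $G_\alpha(0,\cdot)=\delta_0$, where $\frac{d^\alpha}{ds^\alpha}h(s)=\frac{1}{\Gamma(-\alpha)}\int_0^\infty\frac{h(s-\tau)-h(s)}{\tau^{1+\alpha}}\,d\tau$; that is, $G_\alpha(t,\cdot)$ is the density on $(0,\infty)$ with $\int_0^\infty e^{-\lambda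 s}G_\alpha(t,s)\,ds=e^{-t\lambda^\alpha}$, $\lambda\ge0$. Then $$Z(t,x)=\frac1\alpha\int_0^\infty G(t^\alpha s,x)\,s^{-1-\frac1\alpha}\,G_\alpha(1,s^{-\frac1\alpha})\,ds,$$ and $Y$ is the unique solution of $Z(t,x)=\int_0^t g_{1-\alpha}(t-s)Y(s,x)\,ds$. Integral solution: given non-negative $u_0,f$, a function $u:[0,T)\times\mathbb{R}^d\to[0,\infty]$ is an integral solution of the problem if it is measurable, finite almost everywhere, and for almost every $(t,x)\in(0,T)\times\mathbb{R}^d$ satisfies $u(t,x)=\int_{\mathbb{R}^d}Z(t,x-y)u_0(y)\,dy+\int_0^t\int_{\mathbb{R}^d}Y(t-s,x-y)f(u(s,y))\,dy\,ds$. Osgood-type functions: for $k>1$ and a fixed $\phi_0>2^{1/(k-1)}$ put $\phi_i=\phi_{i-1}^k$ for $i\ge1$, and define $f^{[k]}:[0,\infty)\to[0,\infty)$ by $f^{[k]}(s)=(1-\phi_0^{1-k})s^k$ for $s\in[0,\phi_0]$; $f^{[k]}(s)=\phi_i-\phi_{i-1}$ for $s\in[\phi_{i-1},\phi_i/2]$, $i\ge1$; and, for $s\in(\phi_i/2,\phi_i)$, $i\ge1$, $f^{[k]}(s)$ is the affine interpolation between the values of $f^{[k]}$ at $\phi_i/2$ and $\phi_i$. A continuous $f:[0,\infty)\to[0,\infty)$ is of Osgood-type with exponent $k>1$ if (for such an $f^{[k]}$) there are constants $c,C>0$ with $c\,f^{[k]}(s)\le f(s)\le C\,f^{[k]}(s)$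 for all $s\ge0$. *)

theory Defs
  imports "HOL-Analysis.Analysis"
begin

section \<open>The spectral measure and the symbol\<close>

text \<open>
  Surface measure on the unit sphere, obtained from Lebesgue measure by polar coordinates:
  \<open>\<sigma>(A) = d * |{x. 0 < |x| < 1, x/|x| \<in> A}|\<close>.  In dimension one this is the counting measure
  on the two points of norm 1.
\<close>

definition sphere_measure :: "'a::euclidean_space measure" where
  "sphere_measure =
     distr (scale_measure (of_nat DIM('a)) (restrict_space lborel (ball 0 1 - {0})))
       (restrict_space borel (sphere 0 1)) (\<lambda>x. x /\<^sub>R norm x)"

primrec times_cont_diff_on ::
    "nat \<Rightarrow> ('a::euclidean_space \<Rightarrow> real) \<Rightarrow> 'a set \<Rightarrow> bool" where
  "times_cont_diff_on 0 f U \<longleftrightarrow> continuous_on U f"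
| "times_cont_diff_on (Suc m) f U \<longleftrightarrow>
     (\<forall>x\<in>U. f differentiable (at x)) \<and>
     (\<forall>v. times_cont_diff_on m (\<lambda>x. frechet_derivative f (at x) v) U)"

text \<open>A function on the sphere is \<open>C\<^sup>m\<close> iff it extends to a \<open>C\<^sup>m\<close> function on an open neighbourhood.\<close>

definition sphere_times_cont_diff :: "nat \<Rightarrow> ('a::euclidean_space \<Rightarrow> real) \<Rightarrow> bool" where
  "sphere_times_cont_diff m w \<longleftrightarrow>
     (\<exists>U F. open U \<and> sphere 0 1 \<subseteq> U \<and> times_cont_diff_on m F U \<and> (\<forall>\<theta>\<in>sphere 0 1. F \<theta> = w \<theta>))"

definition omega :: "real \<Rightarrow> 'a::euclidean_space measure \<Rightarrow> 'a \<Rightarrow> real" where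
  "omega \<beta> \<nu> \<theta> = (\<integral>\<eta>. \<bar>\<theta> \<bullet> \<eta>\<bar> powr \<beta> \<partial>\<nu>)"

definition spectral_measure :: "real \<Rightarrow> 'a::euclidean_space measure \<Rightarrow> bool" where
  "spectral_measure \<beta> \<nu> \<longleftrightarrow>
     finite_measure \<nu> \<and>
     (\<exists>h \<in> borel_measurable (restrict_space borel (sphere 0 1)).
        (\<forall>\<theta>\<in>sphere 0 1. 0 < h \<theta>) \<and> \<nu> = density sphere_measure (\<lambda>\<theta>. ennreal (h \<theta>))) \<and>
     (\<forall>\<theta>\<in>sphere 0 1. 0 < omega \<beta> \<nu> \<theta>) \<and>
     sphere_times_cont_diff (DIM('a) + 1 + nat \<lfloor>\<beta>\<rfloor>) (omega \<beta> \<nu>)"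

definition psi :: "real \<Rightarrow> 'a::euclidean_space measure \<Rightarrow> 'a \<Rightarrow> real" where
  "psi \<beta> \<nu> \<xi> = norm \<xi> powr \<beta> * omega \<beta> \<nu> (\<xi> /\<^sub>R norm \<xi>)"


section \<open>Kernels\<close>

definition g :: "real \<Rightarrow> real \<Rightarrow> real" where
  "g \<rho> t = t powr (\<rho> - 1) / Gamma \<rho>"

text \<open>The integral is real because the symbol is even; \<open>Re\<close> only changes the type.\<close>

definition G :: "real \<Rightarrow> 'a::euclidean_space measure \<Rightarrow> real \<Rightarrow> 'a \<Rightarrow> real" where
  "G \<beta> \<nu> t x =
     Re (\<integral>\<xi>. cis (x \<bullet> \<xi>) * of_real (exp (- t * psi \<beta> \<nu> \<xi>)) \<partial>lborel) / (2 * pi) ^ DIM('a)"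

text \<open>
  \<open>Ga t\<close> is the one-sided \<open>\<alpha>\<close>-stable density at time \<open>t\<close>.  Its Laplace transform determines it
  up to a null set, which does not affect \<open>Z\<close> below.
\<close>

definition stable_density :: "real \<Rightarrow> (real \<Rightarrow> real \<Rightarrow> real) \<Rightarrow> bool" where
  "stable_density \<alpha> Ga \<longleftrightarrow>
     (\<forall>t>0. Ga t \<in> borel_measurable borel \<and> (\<forall>s>0. 0 \<le> Ga t s) \<and>
        (\<forall>\<mu>\<ge>0. set_integrable lborel {0<..} (\<lambda>s. exp (- \<mu> * s) * Ga t s) \<and>
           (LBINT s:{0<..}. exp (- \<mu> * s) * Ga t s) = exp (- t * \<mu> powr \<alpha>)))"

definition Z ::
    "real \<Rightarrow> real \<Rightarrow> 'a::euclidean_space measure \<Rightarrow> (real \<Rightarrow> real \<Rightarrow> real) \<Rightarrow> real \<Rightarrow> 'a \<Rightarrow> real" where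
  "Z \<alpha> \<beta> \<nu> Ga t x =
     1 / \<alpha> * (LBINT s:{0<..}. G \<beta> \<nu> (t powr \<alpha> * s) x * s powr (- 1 - 1 / \<alpha>) * Ga 1 (s powr (- 1 / \<alpha>)))"

text \<open>
  The equation determining \<open>Y\<close> from \<open>Z\<close>.  The point \<open>x = 0\<close> is left out because \<open>Z t\<close> is in
  general singular there.  For each other \<open>x\<close> the equation has at most one solution up to equality
  for almost every time, so \<open>Y\<close> is determined almost everywhere.
\<close>

definition solves_Y_equation ::
    "real \<Rightarrow> (real \<Rightarrow> 'a::euclidean_space \<Rightarrow> real) \<Rightarrow> (real \<Rightarrow> 'a \<Rightarrow> real) \<Rightarrow> bool" where
  "solves_Y_equation \<alpha> z Y \<longleftrightarrow>
     (\<lambda>(t, x). Y t x) \<in> borel_measurable borel \<and>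
     (\<forall>t>0. \<forall>x. x \<noteq> 0 \<longrightarrow>
        set_integrable lborel {0<..<t} (\<lambda>s. g (1 - \<alpha>) (t - s) * Y s x) \<and>
        z t x = (LBINT s:{0<..<t}. g (1 - \<alpha>) (t - s) * Y s x))"


section \<open>Integral solutions\<close>

definition L1 :: "('a::euclidean_space \<Rightarrow> ennreal) set" where
  "L1 = {v \<in> borel_measurable lebesgue. (\<integral>\<^sup>+x. v x \<partial>lebesgue) < \<infinity>}"

text \<open>
  The kernels and the data are non-negative, so the integrals are taken in \<open>[0,\<infinity>]\<close>.  Since \<open>u\<close> is
  finite almost everywhere, the value assigned to \<open>f \<infinity>\<close> (here \<open>f 0\<close>, through \<open>enn2real\<close>) is
  immaterial.
\<close>

definition integral_solution ::
    "(real \<Rightarrow> 'a::euclidean_space \<Rightarrow> real) \<Rightarrow> (real \<Rightarrow> 'a \<Rightarrow> real) \<Rightarrow> (real \<Rightarrow> real) \<Rightarrow> ('a \<Rightarrow> real)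
      \<Rightarrow> real \<Rightarrow> (real \<Rightarrow> 'a \<Rightarrow> ennreal) \<Rightarrow> bool" where
  "integral_solution z Y f u0 T u \<longleftrightarrow>
     (\<lambda>(t, x). u t x) \<in> borel_measurable (lebesgue_on ({0..<T} \<times> UNIV)) \<and>
     (AE (t, x) in lebesgue_on ({0..<T} \<times> UNIV). u t x < \<infinity>) \<and>
     (AE (t, x) in lebesgue_on ({0<..<T} \<times> UNIV).
        u t x = (\<integral>\<^sup>+y. ennreal (z t (x - y)) * ennreal (u0 y) \<partial>lebesgue)
          + (\<integral>\<^sup>+s\<in>{0<..<t}.
               (\<integral>\<^sup>+y. ennreal (Y (t - s) (x - y)) * ennreal (f (enn2real (u s y))) \<partial>lebesgue)
             \<partial>lebesgue))"


section \<open>Osgood-type functions\<close>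

primrec osgood_seq :: "real \<Rightarrow> real \<Rightarrow> nat \<Rightarrow> real" where
  "osgood_seq k p 0 = p"
| "osgood_seq k p (Suc i) = osgood_seq k p i powr k"

text \<open>
  The function \<open>f\<^sup>[\<^sup>k\<^sup>]\<close> with \<open>\<phi>\<^sub>0 = p\<close>.  For \<open>s > p\<close>, the index \<open>i \<ge> 1\<close> is the one with
  \<open>\<phi>\<^sub>i\<^sub>-\<^sub>1 < s \<le> \<phi>\<^sub>i\<close>; the last branch interpolates between the value \<open>b - a\<close> at \<open>b/2\<close> and the
  value \<open>\<phi>\<^sub>i\<^sub>+\<^sub>1 - \<phi>\<^sub>i = b powr k - b\<close> at \<open>b = \<phi>\<^sub>i\<close>.  The lemmas below recover the defining clauses.
\<close>

definition osgood_fun :: "real \<Rightarrow> real \<Rightarrow> real \<Rightarrow> real" where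
  "osgood_fun k p s =
     (if s \<le> p then (1 - p powr (1 - k)) * s powr k
      else let i = (LEAST i. s \<le> osgood_seq k p i);
               a = osgood_seq k p (i - 1);
               b = osgood_seq k p i
           in if s \<le> b / 2 then b - a
              else (b - a) + (s - b / 2) / (b / 2) * ((b powr k - b) - (b - a)))"

lemma osgood_seq_gt:
  assumes "k > 1" "p > 2 powr (1 / (k - 1))"
  shows "osgood_seq k p i > 2 powr (1 / (k - 1))"
    and "2 * osgood_seq k p i < osgood_seq k p (Suc i)"
proof -
  have step: "2 * x < x powr k" if "x > 2 powr (1 / (k - 1))" for x
  proof -
    have x0: "x > 0"
      using that by (smt (verit) powr_gt_zero)
    have "(2 powr (1 / (k - 1))) powr (k - 1) < x powr (k - 1)"
      using that assms(1) by (intro powr_less_mono2) auto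
    hence "2 < x powr (k - 1)"
      using assms(1) by (simp add: powr_powr)
    moreover have "x powr k = x * x powr (k - 1)"
      using x0 by (simp add: powr_diff)
    ultimately show ?thesis
      using x0 by simp
  qed
  show gt: "osgood_seq k p i > 2 powr (1 / (k - 1))" for i
  proof (induction i)
    case (Suc i)
    have "osgood_seq k p i > 0"
      using Suc by (smt (verit) powr_gt_zero)
    then show ?case
      using step[OF Suc] Suc by simp
  qed (use assms in simp)
  show "2 * osgood_seq k p i < osgood_seq k p (Suc i)"
    using step[OF gt] by simp
qed

lemma osgood_seq_pos:
  assumes "k > 1" "p > 2 powr (1 / (k - 1))"
  shows "osgood_seq k p i > 0"
  using osgood_seq_gt(1)[OF assms] by (smt (verit) powr_gt_zero)

lemma osgood_seq_strict_mono:
  assumes "k > 1" "p > 2 powr (1 / (k - 1))"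
  shows "strict_mono (osgood_seq k p)"
proof (rule strict_monoI_Suc)
  show "osgood_seq k p n < osgood_seq k p (Suc n)" for n
    using osgood_seq_gt(2)[OF assms, of n] osgood_seq_pos[OF assms, of n] by linarith
qed

lemma osgood_index:
  assumes "k > 1" "p > 2 powr (1 / (k - 1))" "osgood_seq k p i < s" "s \<le> osgood_seq k p (Suc i)"
  shows "(LEAST i. s \<le> osgood_seq k p i) = Suc i" "\<not> s \<le> p"
proof -
  have mono: "osgood_seq k p m \<le> osgood_seq k p n" if "m \<le> n" for m n
    using osgood_seq_strict_mono[OF assms(1,2)] that by (simp add: strict_mono_less_eq)
  show "(LEAST i. s \<le> osgood_seq k p i) = Suc i"
  proof (rule Least_equality)
    show "Suc i \<le> j" if "s \<le> osgood_seq k p j" for j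
      using mono[of j i] that assms(3) by (cases "j \<le> i") auto
  qed (fact assms(4))
  show "\<not> s \<le> p"
    using mono[of 0 i] assms(3) by simp
qed

lemma osgood_fun_power:
  "s \<le> p \<Longrightarrow> osgood_fun k p s = (1 - p powr (1 - k)) * s powr k"
  by (simp add: osgood_fun_def)

lemma osgood_fun_seq:
  assumes "k > 1" "p > 2 powr (1 / (k - 1))"
  shows "osgood_fun k p (osgood_seq k p i) = osgood_seq k p (Suc i) - osgood_seq k p i"
proof (cases i)
  case 0
  have "p > 0"
    using osgood_seq_pos[OF assms, of 0] by simp
  then have "p powr (1 - k) * p powr k = p"
    by (simp flip: powr_add)
  then show ?thesis
    using 0 by (simp add: osgood_fun_def left_diff_distrib)
next
  case (Suc j)
  have lt: "osgood_seq k p j < osgood_seq k p (Suc j)"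
    using osgood_seq_strict_mono[OF assms] strict_mono_Suc_iff by blast
  have pos: "osgood_seq k p j powr k > 0"
    using osgood_seq_pos[OF assms, of "Suc j"] by simp
  show ?thesis
    using osgood_index[OF assms lt order_refl] Suc pos
    by (simp add: osgood_fun_def Let_def)
qed

lemma osgood_fun_const:
  assumes "k > 1" "p > 2 powr (1 / (k - 1))"
    and s: "osgood_seq k p i \<le> s" "s \<le> osgood_seq k p (Suc i) / 2"
  shows "osgood_fun k p s = osgood_seq k p (Suc i) - osgood_seq k p i"
proof (cases "s = osgood_seq k p i")
  case True
  then show ?thesis
    using osgood_fun_seq[OF assms(1,2)] by simp
next
  case False
  then have "osgood_seq k p i < s" "s \<le> osgood_seq k p (Suc i)"
    using s osgood_seq_pos[OF assms(1,2), of "Suc i"] by linarith+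
  from osgood_index[OF assms(1,2) this] show ?thesis
    using s by (simp add: osgood_fun_def Let_def)
qed

lemma osgood_fun_affine:
  assumes "k > 1" "p > 2 powr (1 / (k - 1))"
    and s: "osgood_seq k p (Suc i) / 2 < s" "s < osgood_seq k p (Suc i)"
  defines "b \<equiv> osgood_seq k p (Suc i)"
  shows "osgood_fun k p s =
    osgood_fun k p (b / 2) + (s - b / 2) / (b / 2) * (osgood_fun k p b - osgood_fun k p (b / 2))"
proof -
  have "osgood_seq k p i < s"
    using s osgood_seq_gt(2)[OF assms(1,2), of i] by linarith
  note idx = osgood_index[OF assms(1,2) this less_imp_le[OF s(2)]]
  have half: "osgood_fun k p (b / 2) = b - osgood_seq k p i"
    unfolding b_def using osgood_seq_gt(2)[OF assms(1,2), of i]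
    by (intro osgood_fun_const[OF assms(1,2)]) linarith+
  show ?thesis
    unfolding half using idx s osgood_fun_seq[OF assms(1,2), of "Suc i"]
    by (simp add: osgood_fun_def[of k p s] Let_def b_def)
qed

definition osgood_type :: "real \<Rightarrow> (real \<Rightarrow> real) \<Rightarrow> bool" where
  "osgood_type k f \<longleftrightarrow>
     k > 1 \<and> continuous_on {0..} f \<and> (\<forall>s\<ge>0. 0 \<le> f s) \<and>
     (\<exists>p > 2 powr (1 / (k - 1)). \<exists>c>0. \<exists>C>0.
        \<forall>s\<ge>0. c * osgood_fun k p s \<le> f s \<and> f s \<le> C * osgood_fun k p s)"

end

theory Submission
  imports Defs "HOL-Probability.Characteristic_Functions"
begin

text \<open>
  Put \<open>\<gamma> = \<alpha> d / \<beta>\<close>.  Since the symbol is the characteristic exponent of a stable law, \<open>G\<close> is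
  non-negative; with its scaling this gives \<open>Z(t,x) \<ge> c t\<^bsup>-\<gamma>\<^esup>\<close> for \<open>|x| \<le> \<delta> t\<^bsup>\<alpha>/\<beta>\<^esup>\<close>.  For the datum
  \<open>|x|\<^bsup>\<epsilon>-d\<^esup>\<close> on the unit ball any solution then satisfies \<open>u(t,x) \<ge> C t\<^bsup>-q\<^esup>\<close> for \<open>|x| \<le> \<delta> t\<^bsup>\<alpha>/\<beta>\<^esup> / 2\<close>,
  where \<open>q < \<gamma>\<close> is as close to \<open>\<gamma>\<close> as desired.  As \<open>f(\<phi>\<^sub>i) \<ge> c \<phi>\<^sub>i\<^sup>k\<close>, during the time window
  \<open>(s\<^sub>i/2, s\<^sub>i)\<close> with \<open>C s\<^sub>i\<^bsup>-q\<^esup> = \<phi>\<^sub>i\<close> the source \<open>f(u)\<close> produces at least the mass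
  \<open>A\<^sub>i \<approx> \<phi>\<^sub>i\<^sup>k s\<^sub>i\<^bsup>\<gamma>+1\<^esup>\<close>, which tends to infinity because \<open>k > (\<gamma> + 1) / q\<close>.  If \<open>u(t)\<close> stayed
  integrable, the averages of \<open>\<integral>Y\<^sup>+(t-r,x) dx\<close> over \<open>r \<in> (s\<^sub>i/2, s\<^sub>i)\<close> would tend to \<open>0\<close> for almost every
  \<open>t\<close>; then \<open>Y \<le> 0\<close> almost everywhere for small times, contradicting the positivity of \<open>Z\<close>.
\<close>

section \<open>Gaussian Fourier transforms\<close>

text \<open>No sign of \<open>Y\<close> is established: \<open>Y\<close> enters only through its
  Volterra equation with \<open>Z\<close>. The solution formula reads \<open>Y\<close> through
  \<open>ennreal\<close>, so only its positive part acts, and all that is needed about it is that it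
  does not vanish for small times. Since the solution formula holds only almost everywhere, windows
  and averages replace values at single times. A Dirac mass as datum would give the rate \<gamma>
  but is not in \<open>L1\<close>; the power \<epsilon> restores integrability and costs only the
  drop from \<gamma> to \<open>q = \<gamma> - \<alpha> * \<epsilon> / \<beta>\<close>. The mass of a
  window is height \<open>\<phi> powr k\<close> times volume \<open>s powr \<gamma>\<close> times
  duration \<open>s\<close>, and with \<open>s\<close> of order \<open>\<phi> powr (- 1 / q)\<close>
  this is of order \<open>\<phi> powr (k - (\<gamma> + 1) / q)\<close>. The hypothesis
  \<open>k > 1 + 1 / \<gamma>\<close> is what leaves room for \<open>q\<close> between
  \<open>(\<gamma> + 1) / k\<close> and \<gamma>. For large arguments an Osgood-type
  \<open>f\<close> reaches the order of its power only near the points of the sequence, hence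
  discrete windows; monotonicity extends the value there to all larger \<open>u\<close>.\<close>

lemma lborel_integral_scaleR:
  fixes f :: "'a::euclidean_space \<Rightarrow> real"
  assumes "c \<noteq> 0" and [measurable]: "f \<in> borel_measurable borel"
  shows "(\<integral>x. f (c *\<^sub>R x) \<partial>lborel) = (\<integral>x. f x \<partial>lborel) / \<bar>c\<bar> ^ DIM('a)"
proof -
  have "(\<integral>x. f x \<partial>lborel) =
      (\<integral>x. f x \<partial>density (distr lborel borel (\<lambda>x. 0 + c *\<^sub>R x)) (\<lambda>_. ennreal (\<bar>c\<bar> ^ DIM('a))))"
    by (subst lborel_affine[OF assms(1), of 0]) (simp add: ennreal_power)
  also have "\<dots> = \<bar>c\<bar> ^ DIM('a) * (\<integral>x. f (c *\<^sub>R x) \<partial>lborel)"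
    by (simp add: integral_density integral_distr)
  finally show ?thesis using assms(1) by simp
qed

lemma lborel_nn_integral_reflect:
  fixes F :: "'a::euclidean_space \<Rightarrow> ennreal"
  assumes [measurable]: "F \<in> borel_measurable borel"
  shows "(\<integral>\<^sup>+y. F (x - y) \<partial>lborel) = (\<integral>\<^sup>+y. F y \<partial>lborel)"
proof -
  have "(\<integral>\<^sup>+y. F y \<partial>lborel) =
      (\<integral>\<^sup>+y. F y \<partial>density (distr lborel borel (\<lambda>y. x + (- 1) *\<^sub>R y)) (\<lambda>_. ennreal \<bar>- 1\<bar> ^ DIM('a)))"
    by (subst lborel_affine[of "-1" x]) auto
  then show ?thesis
    by (simp add: nn_integral_density nn_integral_distr)
qed

lemma AE_lborel_reflect:
  fixes x :: "'a::euclidean_space"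
  assumes "AE z in lborel. P z"
  shows "AE y in lborel. P (x - y)"
proof -
  from AE_E3[OF assms] obtain N where N: "N \<in> null_sets lborel" "\<And>z. z \<notin> N \<Longrightarrow> P z"
    by auto
  have [measurable]: "N \<in> sets borel" using N by auto
  have "(\<integral>\<^sup>+y. indicator N (x - y) \<partial>lborel) = (\<integral>\<^sup>+y. indicator N y \<partial>lborel)"
    by (rule lborel_nn_integral_reflect) simp
  also have "\<dots> = 0" using N by auto
  finally have "AE y in lborel. indicator N (x - y) = (0::ennreal)"
    by (subst (asm) nn_integral_0_iff_AE) auto
  then show ?thesis by eventually_elim (use N in \<open>auto simp: indicator_def split: if_splits\<close>)
qed

text \<open>Lebesgue measure is the image of the product over \<open>Basis\<close> of
  one-dimensional Lebesgue measures, so both claims are Fubini for products.\<close>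

lemma lborel_integral_prod_Basis:
  fixes h :: "'a::euclidean_space \<Rightarrow> real \<Rightarrow> complex"
  assumes h: "\<And>b. b \<in> Basis \<Longrightarrow> integrable lborel (h b)"
  shows "(\<integral>\<xi>. (\<Prod>b\<in>Basis. h b (\<xi> \<bullet> b)) \<partial>lborel) = (\<Prod>b\<in>Basis. \<integral>x. h b x \<partial>lborel)"
    and "integrable lborel (\<lambda>\<xi>. \<Prod>b\<in>Basis. h b (\<xi> \<bullet> b))"
proof -
  interpret product_sigma_finite "\<lambda>_::'a. lborel :: real measure" ..
  have hm: "h b \<in> borel_measurable borel" if "b \<in> Basis" for b
    using borel_measurable_integrable[OF h[OF that]] by simp
  have meas: "(\<lambda>\<xi>::'a. \<Prod>b\<in>Basis. h b (\<xi> \<bullet> b)) \<in> borel_measurable borel"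
  proof (rule borel_measurable_prod)
    fix b :: 'a assume "b \<in> Basis"
    then have [measurable]: "h b \<in> borel_measurable borel" by (rule hm)
    show "(\<lambda>\<xi>. h b (\<xi> \<bullet> b)) \<in> borel_measurable borel" by measurable
  qed
  have T[measurable]: "(\<lambda>x. \<Sum>b\<in>Basis. x b *\<^sub>R b) \<in> (\<Pi>\<^sub>M b\<in>(Basis::'a set). lborel) \<rightarrow>\<^sub>M borel"
    by simp
  have eq: "(\<Prod>b\<in>Basis. h b ((\<Sum>c\<in>Basis. x c *\<^sub>R c) \<bullet> b)) = (\<Prod>b\<in>(Basis::'a set). h b (x b))" for x
    by (intro prod.cong refl) (simp add: inner_sum_left inner_Basis if_distrib cong: if_cong)
  show "(\<integral>\<xi>. (\<Prod>b\<in>Basis. h b (\<xi> \<bullet> b)) \<partial>lborel) = (\<Prod>b\<in>Basis. \<integral>x. h b x \<partial>lborel)"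
    by (subst lborel_eq, subst integral_distr[OF T meas]) (simp add: eq product_integral_prod h)
  show "integrable lborel (\<lambda>\<xi>. \<Prod>b\<in>Basis. h b (\<xi> \<bullet> b))"
    by (subst lborel_eq, subst integrable_distr_eq[OF T meas])
      (simp add: eq product_integrable_prod h)
qed

text \<open>The characteristic function of the standard normal law with its normalising constant
  removed.\<close>

lemma std_normal_fourier:
  "integrable lborel (\<lambda>x::real. cis (t * x) * of_real (exp (- x\<^sup>2 / 2)))"
  "(\<integral>x. cis (t * x) * of_real (exp (- x\<^sup>2 / 2)) \<partial>lborel) =
     of_real (sqrt (2 * pi) * exp (- t\<^sup>2 / 2))"
proof -
  have eq: "(\<lambda>x. cis (t * x) * of_real (exp (- x\<^sup>2 / 2))) =
      (\<lambda>x. of_real (sqrt (2 * pi)) * (std_normal_density x *\<^sub>R cis (t * x)))"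
  proof
    fix x :: real
    have "exp (- x\<^sup>2 / 2) = sqrt (2 * pi) * std_normal_density x"
      by (simp add: std_normal_density_def)
    then show "cis (t * x) * of_real (exp (- x\<^sup>2 / 2)) =
        of_real (sqrt (2 * pi)) * (std_normal_density x *\<^sub>R cis (t * x))"
      by (simp only: of_real_mult scaleR_conv_of_real mult_ac)
  qed
  have [measurable]: "(\<lambda>x. cis (t * x)) \<in> borel_measurable borel"
    by (intro borel_measurable_continuous_onI continuous_intros)
  have "integrable lborel (\<lambda>x. std_normal_density x *\<^sub>R cis (t * x))"
    by (rule Bochner_Integration.integrable_bound[OF integrable_std_normal_moment[of 0]]) auto
  then show "integrable lborel (\<lambda>x::real. cis (t * x) * of_real (exp (- x\<^sup>2 / 2)))"
    unfolding eq by (rule integrable_mult_right)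
  have "char std_normal_distribution t = (\<integral>x. std_normal_density x *\<^sub>R cis (t * x) \<partial>lborel)"
    by (simp add: char_def integral_density cis_conv_exp)
  then show "(\<integral>x. cis (t * x) * of_real (exp (- x\<^sup>2 / 2)) \<partial>lborel) =
     of_real (sqrt (2 * pi) * exp (- t\<^sup>2 / 2))"
    unfolding eq integral_mult_right_zero by (simp add: char_std_normal_distribution)
qed

lemma gaussian_fourier:
  fixes x :: "'a::euclidean_space"
  shows "integrable lborel (\<lambda>\<xi>. cis (x \<bullet> \<xi>) * of_real (exp (- (norm \<xi>)\<^sup>2 / 2)))"
    and "(\<integral>\<xi>. cis (x \<bullet> \<xi>) * of_real (exp (- (norm \<xi>)\<^sup>2 / 2)) \<partial>lborel) =
      of_real (sqrt (2 * pi) ^ DIM('a) * exp (- (norm x)\<^sup>2 / 2))"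
proof -
  have nrm: "exp (- (norm \<xi>)\<^sup>2 / 2) = (\<Prod>b\<in>Basis. exp (- (\<xi> \<bullet> b)\<^sup>2 / 2))" for \<xi> :: 'a
    unfolding exp_sum[OF finite_Basis, symmetric] power2_norm_eq_inner euclidean_inner[of \<xi> \<xi>]
    by (simp add: power2_eq_square sum_divide_distrib sum_negf)
  have cs: "cis (x \<bullet> \<xi>) = (\<Prod>b\<in>Basis. cis ((x \<bullet> b) * (\<xi> \<bullet> b)))" for \<xi> :: 'a
    by (simp add: cis_conv_exp exp_sum[symmetric] euclidean_inner[of x \<xi>] sum_distrib_left)
  have eq: "cis (x \<bullet> \<xi>) * of_real (exp (- (norm \<xi>)\<^sup>2 / 2)) =
      (\<Prod>b\<in>Basis. cis ((x \<bullet> b) * (\<xi> \<bullet> b)) * of_real (exp (- (\<xi> \<bullet> b)\<^sup>2 / 2)))" for \<xi> :: 'a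
    unfolding nrm cs prod.distrib by simp
  note L = lborel_integral_prod_Basis[of "\<lambda>b r. cis ((x \<bullet> b) * r) * of_real (exp (- r\<^sup>2 / 2))",
      OF std_normal_fourier(1)]
  show "integrable lborel (\<lambda>\<xi>. cis (x \<bullet> \<xi>) * of_real (exp (- (norm \<xi>)\<^sup>2 / 2)))"
    unfolding eq by (rule L(2))
  show "(\<integral>\<xi>. cis (x \<bullet> \<xi>) * of_real (exp (- (norm \<xi>)\<^sup>2 / 2)) \<partial>lborel) =
      of_real (sqrt (2 * pi) ^ DIM('a) * exp (- (norm x)\<^sup>2 / 2))"
    unfolding eq L(1) std_normal_fourier(2) nrm[of x] by (simp only: of_real_mult of_real_prod of_real_power prod.distrib prod_constant)
qed

lemma gaussian_cos:
  fixes x :: "'a::euclidean_space"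
  assumes "\<epsilon> > 0"
  shows integrable_gaussian: "integrable lborel (\<lambda>\<xi>::'a. exp (- (norm (\<epsilon> *\<^sub>R \<xi>))\<^sup>2 / 2))"
    and gaussian_cos_integral: "(\<integral>\<xi>. cos (x \<bullet> \<xi>) * exp (- (norm (\<epsilon> *\<^sub>R \<xi>))\<^sup>2 / 2) \<partial>lborel) =
      (sqrt (2 * pi) / \<epsilon>) ^ DIM('a) * exp (- (norm (x /\<^sub>R \<epsilon>))\<^sup>2 / 2)"
proof -
  have 1: "integrable lborel (\<lambda>\<xi>::'a. exp (- (norm \<xi>)\<^sup>2 / 2))"
    using integrable_norm[OF gaussian_fourier(1)[of "0::'a"]] by (simp add: norm_mult)
  have "integrable (density (distr lborel borel (\<lambda>x. 0 + \<epsilon> *\<^sub>R x)) (\<lambda>_. ennreal (\<bar>\<epsilon>\<bar> ^ DIM('a))))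
      (\<lambda>\<xi>::'a. exp (- (norm \<xi>)\<^sup>2 / 2))"
    using 1 assms by (subst (asm) lborel_affine[of \<epsilon> 0]) (auto simp: ennreal_power)
  then show "integrable lborel (\<lambda>\<xi>::'a. exp (- (norm (\<epsilon> *\<^sub>R \<xi>))\<^sup>2 / 2))"
    using assms by (subst (asm) integrable_density; simp add: integrable_distr_eq)
  have first: "(\<integral>\<xi>. cos ((x /\<^sub>R \<epsilon>) \<bullet> \<xi>) * exp (- (norm \<xi>)\<^sup>2 / 2) \<partial>lborel) =
      sqrt (2 * pi) ^ DIM('a) * exp (- (norm (x /\<^sub>R \<epsilon>))\<^sup>2 / 2)"
    using integral_Re[OF gaussian_fourier(1)[of "x /\<^sub>R \<epsilon>"]] unfolding gaussian_fourier(2) by simp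
  have sc: "(\<integral>\<xi>. cos ((x /\<^sub>R \<epsilon>) \<bullet> (\<epsilon> *\<^sub>R \<xi>)) * exp (- (norm (\<epsilon> *\<^sub>R \<xi>))\<^sup>2 / 2) \<partial>lborel) =
     (\<integral>\<xi>. cos ((x /\<^sub>R \<epsilon>) \<bullet> \<xi>) * exp (- (norm \<xi>)\<^sup>2 / 2) \<partial>lborel) / \<bar>\<epsilon>\<bar> ^ DIM('a)"
    using assms by (intro lborel_integral_scaleR) auto
  have cancel: "(x /\<^sub>R \<epsilon>) \<bullet> (\<epsilon> *\<^sub>R \<xi>) = x \<bullet> \<xi>" for \<xi>
    using assms by simp
  from first show "(\<integral>\<xi>. cos (x \<bullet> \<xi>) * exp (- (norm (\<epsilon> *\<^sub>R \<xi>))\<^sup>2 / 2) \<partial>lborel) =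
      (sqrt (2 * pi) / \<epsilon>) ^ DIM('a) * exp (- (norm (x /\<^sub>R \<epsilon>))\<^sup>2 / 2)"
    unfolding sc[unfolded cancel] using assms by (simp only: power_divide abs_of_pos times_divide_eq_left)
qed

section \<open>Positive definite functions\<close>

text \<open>
  Positive definiteness in Fourier-dual form.  The Gaussian factor makes sense of the Fourier
  integral for functions that are only bounded, such as constants and cosines.
\<close>

definition gauss_posdef :: "('a::euclidean_space \<Rightarrow> real) \<Rightarrow> bool" where
  "gauss_posdef \<phi> \<longleftrightarrow> \<phi> \<in> borel_measurable borel \<and> (\<exists>B. \<forall>\<xi>. \<bar>\<phi> \<xi>\<bar> \<le> B) \<and>
     (\<forall>\<epsilon>>0. \<forall>x. 0 \<le> (\<integral>\<xi>. cos (x \<bullet> \<xi>) * \<phi> \<xi> * exp (- (norm (\<epsilon> *\<^sub>R \<xi>))\<^sup>2 / 2) \<partial>lborel))"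

lemma gauss_posdef_measurable: "gauss_posdef \<phi> \<Longrightarrow> \<phi> \<in> borel_measurable borel"
  by (simp add: gauss_posdef_def)

lemma gauss_posdef_bounded: "gauss_posdef \<phi> \<Longrightarrow> \<exists>B\<ge>0. \<forall>\<xi>. \<bar>\<phi> \<xi>\<bar> \<le> B"
  unfolding gauss_posdef_def by (meson abs_ge_zero order_trans)

lemma gauss_posdef_nonneg:
  "gauss_posdef \<phi> \<Longrightarrow> \<epsilon> > 0 \<Longrightarrow>
    0 \<le> (\<integral>\<xi>. cos (x \<bullet> \<xi>) * \<phi> \<xi> * exp (- (norm (\<epsilon> *\<^sub>R \<xi>))\<^sup>2 / 2) \<partial>lborel)"
  by (simp add: gauss_posdef_def)

lemma gauss_posdef_integrable:
  assumes "gauss_posdef \<phi>" "\<epsilon> > 0"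
  shows "integrable lborel (\<lambda>\<xi>. cos (x \<bullet> \<xi>) * \<phi> \<xi> * exp (- (norm (\<epsilon> *\<^sub>R \<xi>))\<^sup>2 / 2))"
proof -
  obtain B where B: "B \<ge> 0" "\<And>\<xi>. \<bar>\<phi> \<xi>\<bar> \<le> B" using gauss_posdef_bounded[OF assms(1)] by auto
  note [measurable] = gauss_posdef_measurable[OF assms(1)]
  show ?thesis
  proof (rule Bochner_Integration.integrable_bound)
    show "integrable lborel (\<lambda>\<xi>. B * exp (- (norm (\<epsilon> *\<^sub>R \<xi>))\<^sup>2 / 2))"
      using integrable_gaussian[OF assms(2)] by (rule integrable_mult_right)
    have "\<bar>cos (x \<bullet> \<xi>)\<bar> * \<bar>\<phi> \<xi>\<bar> \<le> 1 * B" for \<xi> using B by (intro mult_mono) auto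
    then show "AE \<xi> in lborel. norm (cos (x \<bullet> \<xi>) * \<phi> \<xi> * exp (- (norm (\<epsilon> *\<^sub>R \<xi>))\<^sup>2 / 2))
        \<le> norm (B * exp (- (norm (\<epsilon> *\<^sub>R \<xi>))\<^sup>2 / 2))"
      using B by (auto simp: abs_mult intro!: AE_I2)
  qed measurable
qed

lemma gauss_posdef_one: "gauss_posdef (\<lambda>_. 1)"
  unfolding gauss_posdef_def mult_1_right
proof (intro conjI allI impI)
  show "0 \<le> (\<integral>\<xi>. cos (x \<bullet> \<xi>) * exp (- (norm (\<epsilon> *\<^sub>R \<xi>))\<^sup>2 / 2) \<partial>lborel)"
    if "0 < \<epsilon>" for \<epsilon> and x :: 'a
    unfolding gaussian_cos_integral[OF that] using that by simp
qed auto

lemma gauss_posdef_add: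
  assumes "gauss_posdef \<phi>" "gauss_posdef \<psi>"
  shows "gauss_posdef (\<lambda>\<xi>. \<phi> \<xi> + \<psi> \<xi>)"
proof -
  obtain B C where "B \<ge> 0" "\<And>\<xi>. \<bar>\<phi> \<xi>\<bar> \<le> B" "C \<ge> 0" "\<And>\<xi>. \<bar>\<psi> \<xi>\<bar> \<le> C"
    using gauss_posdef_bounded[OF assms(1)] gauss_posdef_bounded[OF assms(2)] by auto
  then have "\<exists>B. \<forall>\<xi>. \<bar>\<phi> \<xi> + \<psi> \<xi>\<bar> \<le> B"
    by (intro exI[of _ "B + C"] allI) (meson abs_triangle_ineq add_mono order_trans)
  then show ?thesis
    using gauss_posdef_measurable[OF assms(1)] gauss_posdef_measurable[OF assms(2)]
      gauss_posdef_nonneg[OF assms(1)] gauss_posdef_nonneg[OF assms(2)]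
      gauss_posdef_integrable[OF assms(1)] gauss_posdef_integrable[OF assms(2)]
    unfolding gauss_posdef_def by (auto simp: distrib_left distrib_right simp del: norm_scaleR)
qed

lemma gauss_posdef_cmult:
  assumes "gauss_posdef \<phi>" "0 \<le> c"
  shows "gauss_posdef (\<lambda>\<xi>. c * \<phi> \<xi>)"
proof -
  obtain B where "\<And>\<xi>. \<bar>\<phi> \<xi>\<bar> \<le> B" using gauss_posdef_bounded[OF assms(1)] by auto
  then have "\<exists>B. \<forall>\<xi>. \<bar>c * \<phi> \<xi>\<bar> \<le> B"
    using assms(2) by (intro exI[of _ "c * B"] allI) (simp add: abs_mult mult_left_mono)
  moreover have "cos (x \<bullet> \<xi>) * (c * \<phi> \<xi>) * exp (- (norm (\<epsilon> *\<^sub>R \<xi>))\<^sup>2 / 2) =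
      c * (cos (x \<bullet> \<xi>) * \<phi> \<xi> * exp (- (norm (\<epsilon> *\<^sub>R \<xi>))\<^sup>2 / 2))" for x \<xi> \<epsilon>
    by (simp add: mult_ac)
  then have "0 \<le> (\<integral>\<xi>. cos (x \<bullet> \<xi>) * (c * \<phi> \<xi>) * exp (- (norm (\<epsilon> *\<^sub>R \<xi>))\<^sup>2 / 2) \<partial>lborel)"
    if "0 < \<epsilon>" for \<epsilon> x
    using gauss_posdef_nonneg[OF assms(1) that] assms(2)
    by (simp only: integral_mult_right_zero mult_nonneg_nonneg)
  ultimately show ?thesis
    using gauss_posdef_measurable[OF assms(1)] unfolding gauss_posdef_def by simp
qed

text \<open>The Gaussian weight supplies the integrable majorant, so a uniform bound on the
  functions suffices for dominated convergence; the limit need not be integrable.\<close>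

lemma gauss_posdef_limit:
  assumes "\<And>n. gauss_posdef (\<phi> n)" "\<And>n \<xi>. \<bar>\<phi> n \<xi>\<bar> \<le> B" "\<And>\<xi>. (\<lambda>n. \<phi> n \<xi>) \<longlonglongrightarrow> \<psi> \<xi>"
  shows "gauss_posdef \<psi>"
proof -
  note [measurable] = gauss_posdef_measurable[OF assms(1)]
  have meas[measurable]: "\<psi> \<in> borel_measurable borel"
    by (rule borel_measurable_LIMSEQ_real[OF assms(3)]) auto
  have B: "\<bar>\<psi> \<xi>\<bar> \<le> B" for \<xi>
    by (rule LIMSEQ_le_const2[OF tendsto_rabs[OF assms(3)]]) (use assms(2) in auto)
  have "0 \<le> (\<integral>\<xi>. cos (x \<bullet> \<xi>) * \<psi> \<xi> * exp (- (norm (\<epsilon> *\<^sub>R \<xi>))\<^sup>2 / 2) \<partial>lborel)" if "\<epsilon> > 0" for \<epsilon> x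
  proof (rule LIMSEQ_le_const)
    show "(\<lambda>n. \<integral>\<xi>. cos (x \<bullet> \<xi>) * \<phi> n \<xi> * exp (- (norm (\<epsilon> *\<^sub>R \<xi>))\<^sup>2 / 2) \<partial>lborel) \<longlonglongrightarrow>
      (\<integral>\<xi>. cos (x \<bullet> \<xi>) * \<psi> \<xi> * exp (- (norm (\<epsilon> *\<^sub>R \<xi>))\<^sup>2 / 2) \<partial>lborel)"
    proof (rule integral_dominated_convergence)
      show "integrable lborel (\<lambda>\<xi>. B * exp (- (norm (\<epsilon> *\<^sub>R \<xi>))\<^sup>2 / 2))"
        using integrable_gaussian[OF that] by (rule integrable_mult_right)
      show "AE \<xi> in lborel. (\<lambda>n. cos (x \<bullet> \<xi>) * \<phi> n \<xi> * exp (- (norm (\<epsilon> *\<^sub>R \<xi>))\<^sup>2 / 2)) \<longlonglongrightarrow>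
          cos (x \<bullet> \<xi>) * \<psi> \<xi> * exp (- (norm (\<epsilon> *\<^sub>R \<xi>))\<^sup>2 / 2)"
        by (intro AE_I2 tendsto_intros assms)
      have "\<bar>cos (x \<bullet> \<xi>)\<bar> * \<bar>\<phi> n \<xi>\<bar> \<le> 1 * B" for \<xi> n using assms(2) by (intro mult_mono) auto
      then show "AE \<xi> in lborel. norm (cos (x \<bullet> \<xi>) * \<phi> n \<xi> * exp (- (norm (\<epsilon> *\<^sub>R \<xi>))\<^sup>2 / 2))
        \<le> B * exp (- (norm (\<epsilon> *\<^sub>R \<xi>))\<^sup>2 / 2)" for n
        by (auto simp: abs_mult intro!: AE_I2)
    qed measurable
    show "\<exists>N. \<forall>n\<ge>N. 0 \<le> (\<integral>\<xi>. cos (x \<bullet> \<xi>) * \<phi> n \<xi> * exp (- (norm (\<epsilon> *\<^sub>R \<xi>))\<^sup>2 / 2) \<partial>lborel)"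
      using gauss_posdef_nonneg[OF assms(1) that] by blast
  qed
  with meas B show ?thesis unfolding gauss_posdef_def by blast
qed

text \<open>The product \<open>cos (x \<bullet> \<xi>) * cos (y p \<bullet> \<xi>)\<close> is half
  the sum of the cosines at \<open>x + y p\<close> and \<open>x - y p\<close>. After Fubini the new
  integral is therefore a superposition of integrals already known to be non-negative for
  \<phi>.\<close>

lemma gauss_posdef_mult_cos_transform:
  fixes y :: "'p \<Rightarrow> 'a::euclidean_space"
  assumes "gauss_posdef \<phi>" "finite_measure M" and [measurable]: "y \<in> borel_measurable M"
  shows "gauss_posdef (\<lambda>\<xi>. \<phi> \<xi> * (\<integral>p. cos (y p \<bullet> \<xi>) \<partial>M))"
proof -
  interpret finite_measure M by fact
  interpret pair_sigma_finite M "lborel :: 'a measure" ..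
  note [measurable] = gauss_posdef_measurable[OF assms(1)]
  obtain B where B: "B \<ge> 0" "\<And>\<xi>. \<bar>\<phi> \<xi>\<bar> \<le> B" using gauss_posdef_bounded[OF assms(1)] by auto
  have mb: "\<bar>\<integral>p. cos (y p \<bullet> \<xi>) \<partial>M\<bar> \<le> measure M (space M)" for \<xi>
  proof -
    have "norm (\<integral>p. cos (y p \<bullet> \<xi>) \<partial>M) \<le> (\<integral>p. 1 \<partial>M)"
      by (rule order_trans[OF integral_norm_bound integral_mono])
        (auto intro!: integrable_const_bound[where B=1])
    then show ?thesis by simp
  qed
  have bd: "\<exists>B. \<forall>\<xi>. \<bar>\<phi> \<xi> * (\<integral>p. cos (y p \<bullet> \<xi>) \<partial>M)\<bar> \<le> B"
    using B mb by (intro exI[of _ "B * measure M (space M)"]) (simp add: abs_mult mult_mono)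
  have pos: "0 \<le> (\<integral>\<xi>. cos (x \<bullet> \<xi>) * (\<phi> \<xi> * (\<integral>p. cos (y p \<bullet> \<xi>) \<partial>M)) *
      exp (- (norm (\<epsilon> *\<^sub>R \<xi>))\<^sup>2 / 2) \<partial>lborel)" if "\<epsilon> > 0" for \<epsilon> x
  proof -
    define h where "h p \<xi> = cos (x \<bullet> \<xi>) * \<phi> \<xi> * cos (y p \<bullet> \<xi>) * exp (- (norm (\<epsilon> *\<^sub>R \<xi>))\<^sup>2 / 2)" for p \<xi>
    have [measurable]: "case_prod h \<in> borel_measurable (M \<Otimes>\<^sub>M lborel)"
      unfolding h_def by measurable
    have int: "integrable (M \<Otimes>\<^sub>M lborel) (case_prod h)"
    proof (rule Bochner_Integration.integrable_bound)
      show "integrable (M \<Otimes>\<^sub>M lborel) (\<lambda>(p, \<xi>::'a). B * exp (- (norm (\<epsilon> *\<^sub>R \<xi>))\<^sup>2 / 2))"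
        using integrable_gaussian[OF that, where 'a='a] B(1)
        by (intro Fubini_integrable) (auto simp: abs_mult simp del: norm_scaleR)
      have "\<bar>cos (x \<bullet> \<xi>)\<bar> * (\<bar>\<phi> \<xi>\<bar> * \<bar>cos (y p \<bullet> \<xi>)\<bar>) \<le> 1 * (B * 1)" for \<xi> p
        using B by (intro mult_mono) auto
      then show "AE z in M \<Otimes>\<^sub>M lborel. norm (case_prod h z)
          \<le> norm (case z of (p, \<xi>) \<Rightarrow> B * exp (- (norm (\<epsilon> *\<^sub>R \<xi>))\<^sup>2 / 2))"
        using B by (auto simp: abs_mult h_def intro!: AE_I2)
    qed measurable
    have "(\<integral>\<xi>. cos (x \<bullet> \<xi>) * (\<phi> \<xi> * (\<integral>p. cos (y p \<bullet> \<xi>) \<partial>M)) * exp (- (norm (\<epsilon> *\<^sub>R \<xi>))\<^sup>2 / 2) \<partial>lborel)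
        = (\<integral>\<xi>. (\<integral>p. h p \<xi> \<partial>M) \<partial>lborel)"
      by (simp add: h_def mult_ac)
    also have "\<dots> = (\<integral>p. (\<integral>\<xi>. h p \<xi> \<partial>lborel) \<partial>M)"
      by (rule Fubini_integral[OF int])
    also have "\<dots> \<ge> 0"
    proof (rule Bochner_Integration.integral_nonneg)
      fix p
      have h: "h p \<xi> =
         (cos ((x + y p) \<bullet> \<xi>) * \<phi> \<xi> * exp (- (norm (\<epsilon> *\<^sub>R \<xi>))\<^sup>2 / 2)) / 2 +
         (cos ((x - y p) \<bullet> \<xi>) * \<phi> \<xi> * exp (- (norm (\<epsilon> *\<^sub>R \<xi>))\<^sup>2 / 2)) / 2" for \<xi>
        unfolding h_def by (simp add: inner_add_left inner_diff_left cos_add cos_diff field_simps)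
      show "0 \<le> (\<integral>\<xi>. h p \<xi> \<partial>lborel)"
        unfolding h using gauss_posdef_integrable[OF assms(1) that] gauss_posdef_nonneg[OF assms(1) that]
        by (subst Bochner_Integration.integral_add) (simp_all del: norm_scaleR)
    qed
    finally show ?thesis .
  qed
  show ?thesis
    unfolding gauss_posdef_def using bd pos by auto
qed

text \<open>This is the compound Poisson law: with \<open>L\<close> the total mass and
  \<open>m\<close> the cosine transform, the function is \<open>exp (- \<tau> * L)\<close> times the
  series with terms \<open>\<tau> ^ n / fact n * m \<xi> ^ n\<close>. The coefficients are
  non-negative, so positivity passes from powers of \<open>m\<close> to partial sums and to the
  limit.\<close>

lemma gauss_posdef_exp_cos_transform:
  fixes y :: "'p \<Rightarrow> 'a::euclidean_space"
  assumes "finite_measure M" and [measurable]: "y \<in> borel_measurable M" and "0 \<le> \<tau>"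
  shows "gauss_posdef (\<lambda>\<xi>. exp (- \<tau> * (\<integral>p. 1 - cos (y p \<bullet> \<xi>) \<partial>M)))"
proof -
  interpret finite_measure M by fact
  define m where "m \<xi> = (\<integral>p. cos (y p \<bullet> \<xi>) \<partial>M)" for \<xi>
  define L where "L = measure M (space M)"
  have int: "integrable M (\<lambda>p. cos (y p \<bullet> \<xi>))" for \<xi>
    by (auto intro!: integrable_const_bound[where B=1])
  have mb: "\<bar>m \<xi>\<bar> \<le> L" for \<xi>
  proof -
    have "norm (\<integral>p. cos (y p \<bullet> \<xi>) \<partial>M) \<le> (\<integral>p. 1 \<partial>M)"
      by (rule order_trans[OF integral_norm_bound integral_mono]) (auto intro!: int integrable_norm)
    then show ?thesis by (simp add: m_def L_def)
  qed
  have pw: "gauss_posdef (\<lambda>\<xi>. m \<xi> ^ n)" for n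
  proof (induction n)
    case (Suc n)
    then show ?case
      using gauss_posdef_mult_cos_transform[OF Suc assms(1,2)] by (simp add: m_def mult.commute)
  qed (simp add: gauss_posdef_one)
  have sm: "gauss_posdef (\<lambda>\<xi>. \<Sum>n<N. (\<tau> ^ n / fact n) * m \<xi> ^ n)" for N
  proof (induction N)
    case 0
    then show ?case using gauss_posdef_cmult[OF gauss_posdef_one, of 0] by simp
  next
    case (Suc N)
    then show ?case
      using gauss_posdef_add[OF Suc gauss_posdef_cmult[OF pw, of "\<tau> ^ N / fact N"]] assms(3) by simp
  qed
  have "gauss_posdef (\<lambda>\<xi>. exp (\<tau> * m \<xi>))"
  proof (rule gauss_posdef_limit[OF sm])
    have s: "(\<lambda>n. \<tau> ^ n / fact n * a ^ n) sums exp (\<tau> * a)" for a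
      using exp_converges[of "\<tau> * a"] by (simp add: power_mult_distrib divide_inverse mult_ac)
    then show "(\<lambda>N. \<Sum>n<N. \<tau> ^ n / fact n * m \<xi> ^ n) \<longlonglongrightarrow> exp (\<tau> * m \<xi>)" for \<xi>
      by (simp add: sums_def)
    fix N \<xi>
    \<comment> \<open>As \<open>m\<close> is bounded by \<open>L\<close>, the exponential series at
      \<open>L\<close> bounds all partial sums at once, as the limit lemma requires.\<close>
    have "\<bar>\<Sum>n<N. \<tau> ^ n / fact n * m \<xi> ^ n\<bar> \<le> (\<Sum>n<N. \<tau> ^ n / fact n * L ^ n)"
      by (rule order_trans[OF sum_abs], rule sum_mono)
        (use assms(3) mb in \<open>auto simp: abs_mult power_abs intro!: divide_right_mono mult_left_mono power_mono\<close>)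
    also have "\<dots> \<le> (\<Sum>n. \<tau> ^ n / fact n * L ^ n)"
      by (rule sum_le_suminf) (use s[of L] assms(3) in \<open>auto simp: sums_iff L_def\<close>)
    also have "\<dots> = exp (\<tau> * L)" using s[of L] by (simp add: sums_iff)
    finally show "\<bar>\<Sum>n<N. \<tau> ^ n / fact n * m \<xi> ^ n\<bar> \<le> exp (\<tau> * L)" .
  qed
  from gauss_posdef_cmult[OF this, of "exp (- \<tau> * L)"]
  have "gauss_posdef (\<lambda>\<xi>. exp (- \<tau> * L) * exp (\<tau> * m \<xi>))" by simp
  moreover have "(\<integral>p. 1 - cos (y p \<bullet> \<xi>) \<partial>M) = L - m \<xi>" for \<xi>
    by (simp add: int m_def L_def)
  then have "exp (- \<tau> * L) * exp (\<tau> * m \<xi>) = exp (- \<tau> * (\<integral>p. 1 - cos (y p \<bullet> \<xi>) \<partial>M))" for \<xi>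
    by (simp add: right_diff_distrib flip: exp_add)
  ultimately show ?thesis by simp
qed

text \<open>For an integrable \<phi> the Gaussian factor can be removed by letting its parameter
  tend to 0; \<phi> itself is then the majorant.\<close>

lemma gauss_posdef_fourier_nonneg:
  fixes \<phi> :: "'a::euclidean_space \<Rightarrow> real"
  assumes "gauss_posdef \<phi>" "integrable lborel \<phi>"
  shows "0 \<le> (\<integral>\<xi>. cos (x \<bullet> \<xi>) * \<phi> \<xi> \<partial>lborel)"
proof (rule LIMSEQ_le_const)
  let ?e = "\<lambda>n. inverse (real (Suc n))"
  note [measurable] = gauss_posdef_measurable[OF assms(1)]
  show "(\<lambda>n. \<integral>\<xi>. cos (x \<bullet> \<xi>) * \<phi> \<xi> * exp (- (norm (?e n *\<^sub>R \<xi>))\<^sup>2 / 2) \<partial>lborel) \<longlonglongrightarrow>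
      (\<integral>\<xi>. cos (x \<bullet> \<xi>) * \<phi> \<xi> \<partial>lborel)"
  proof (rule integral_dominated_convergence)
    show "integrable lborel (\<lambda>\<xi>. \<bar>\<phi> \<xi>\<bar>)" using assms(2) by simp
    have "(\<lambda>n. cos (x \<bullet> \<xi>) * \<phi> \<xi> * exp (- (norm (?e n *\<^sub>R \<xi>))\<^sup>2 / 2)) \<longlonglongrightarrow>
        cos (x \<bullet> \<xi>) * \<phi> \<xi> * exp (- (norm (0 *\<^sub>R \<xi>))\<^sup>2 / 2)" for \<xi>
      by (intro tendsto_intros LIMSEQ_inverse_real_of_nat) simp
    then show "AE \<xi> in lborel. (\<lambda>n. cos (x \<bullet> \<xi>) * \<phi> \<xi> * exp (- (norm (?e n *\<^sub>R \<xi>))\<^sup>2 / 2)) \<longlonglongrightarrow>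
        cos (x \<bullet> \<xi>) * \<phi> \<xi>" by simp
    have "\<bar>cos (x \<bullet> \<xi>)\<bar> * \<bar>\<phi> \<xi>\<bar> * \<bar>exp (- (norm (?e n *\<^sub>R \<xi>))\<^sup>2 / 2)\<bar> \<le> 1 * \<bar>\<phi> \<xi>\<bar> * 1" for \<xi> n
      by (intro mult_mono) auto
    then show "AE \<xi> in lborel. norm (cos (x \<bullet> \<xi>) * \<phi> \<xi> * exp (- (norm (?e n *\<^sub>R \<xi>))\<^sup>2 / 2)) \<le> \<bar>\<phi> \<xi>\<bar>" for n
      by (intro AE_I2) (simp only: real_norm_def abs_mult mult_1 mult_1_right)
  qed measurable
  show "\<exists>N. \<forall>n\<ge>N. 0 \<le> (\<integral>\<xi>. cos (x \<bullet> \<xi>) * \<phi> \<xi> * exp (- (norm (?e n *\<^sub>R \<xi>))\<^sup>2 / 2) \<partial>lborel)"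
    using gauss_posdef_nonneg[OF assms(1)] by simp
qed

section \<open>The symbol as a characteristic exponent\<close>

text \<open>The normalising constant of the symmetric stable exponent on the line: the radial
  integral of \<open>1 - cos (r * u)\<close> against the Levy density is
  \<open>\<bar>u\<bar> powr \<beta>\<close> times it. Values in \<open>ennreal\<close> let this
  scaling identity be stated without finiteness.\<close>

definition levy_const :: "real \<Rightarrow> ennreal" where
  "levy_const \<beta> = (\<integral>\<^sup>+r\<in>{0<..}. ennreal ((1 - cos r) * r powr (- 1 - \<beta>)) \<partial>lborel)"

text \<open>The integrand is strictly positive between \<open>pi/2\<close> and \<open>pi\<close>, so
  it cannot vanish almost everywhere.\<close>

lemma levy_const_pos: "levy_const \<beta> > 0"
proof -
  have "levy_const \<beta> \<noteq> 0"
  proof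
    assume "levy_const \<beta> = 0"
    then have "AE r in lborel. ennreal ((1 - cos r) * r powr (- 1 - \<beta>)) * indicator {0<..} r = 0"
      unfolding levy_const_def by (subst (asm) nn_integral_0_iff_AE) auto
    then have "AE r in lborel. r \<notin> {pi/2<..<pi}"
    proof eventually_elim
      case (elim r)
      show ?case
      proof
        assume r: "r \<in> {pi/2<..<pi}"
        have r0: "0 < r" using r pi_gt_zero by (meson greaterThanLessThan_iff half_gt_zero less_trans)
        have "cos r < cos (pi/2)" using r by (intro cos_monotone_0_pi) auto
        then have "0 < (1 - cos r) * r powr (- 1 - \<beta>)" using r0 by simp
        then show False using elim r0 by simp
      qed
    qed
    then have "emeasure lborel {pi/2<..<pi} = 0"
      by (subst (asm) AE_iff_measurable[OF _ refl]) (auto simp: Collect_conv_if greaterThanLessThan_def greaterThan_def lessThan_def Int_def)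
    then show False by simp
  qed
  then show ?thesis by (simp add: zero_less_iff_neq_zero)
qed

text \<open>Near 0 the bound \<open>1 - cos r \<le> r\<^sup>2\<close> makes the integral converge
  because \<beta> < 2; at infinity the bound 2 does so because \<beta> > 0.\<close>

lemma levy_const_finite:
  assumes "0 < \<beta>" "\<beta> < 2"
  shows "levy_const \<beta> < \<infinity>"
proof -
  have 1: "(\<integral>\<^sup>+r. ennreal (indicator {0..1} r * r powr (1 - \<beta>)) \<partial>lborel) = ennreal (1 / (2 - \<beta>))"
  proof -
    have "((\<lambda>r. r powr (1 - \<beta>)) has_integral (1 powr (1 - \<beta> + 1) / (1 - \<beta> + 1))) {0..1}"
      using assms by (intro has_integral_powr_from_0) auto
    then show ?thesis
      by (intro nn_integral_has_integral_lebesgue) auto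
  qed
  have 2: "(\<integral>\<^sup>+r. ennreal (indicator {1..} r * r powr (- 1 - \<beta>)) \<partial>lborel) = ennreal (1 / \<beta>)"
  proof -
    have "((\<lambda>r. r powr (- 1 - \<beta>)) has_integral (- (1 powr (- 1 - \<beta> + 1)) / (- 1 - \<beta> + 1))) {1..}"
      using assms by (intro has_integral_powr_to_inf) auto
    then show ?thesis
      by (intro nn_integral_has_integral_lebesgue) auto
  qed
  have cos_bound: "1 - cos r \<le> r\<^sup>2" for r :: real
  proof -
    have "1 - cos r = 2 * (sin (r/2))\<^sup>2" using cos_double_sin[of "r/2"] by simp
    also have "(sin (r/2))\<^sup>2 \<le> (r/2)\<^sup>2"
      using abs_sin_x_le_abs_x[of "r/2"] by (metis abs_le_square_iff)
    finally show ?thesis by (simp add: power2_eq_square) (smt (verit) zero_le_square)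
  qed
  have "levy_const \<beta> \<le> (\<integral>\<^sup>+r. ennreal (indicator {0..1} r * r powr (1 - \<beta>)) +
      2 * ennreal (indicator {1..} r * r powr (- 1 - \<beta>)) \<partial>lborel)"
    unfolding levy_const_def
  proof (intro nn_integral_mono)
    fix r :: real
    show "ennreal ((1 - cos r) * r powr (- 1 - \<beta>)) * indicator {0<..} r \<le>
      ennreal (indicator {0..1} r * r powr (1 - \<beta>)) + 2 * ennreal (indicator {1..} r * r powr (- 1 - \<beta>))"
    proof (cases "0 < r \<and> r < 1")
      case True
      have "(1 - cos r) * r powr (- 1 - \<beta>) \<le> r\<^sup>2 * r powr (- 1 - \<beta>)"
        by (intro mult_right_mono cos_bound) auto
      also have "\<dots> = r powr (1 - \<beta>)"
        using True by (simp flip: powr_numeral powr_add)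
      finally show ?thesis using True by (simp add: ennreal_leI)
    next
      case False
      have "(1 - cos r) * r powr (- 1 - \<beta>) \<le> 2 * r powr (- 1 - \<beta>)"
        using cos_ge_minus_one[of r] by (intro mult_right_mono) (linarith, auto)
      then have "ennreal ((1 - cos r) * r powr (- 1 - \<beta>)) \<le> 2 * ennreal (r powr (- 1 - \<beta>))"
        by (metis ennreal_leI ennreal_mult' ennreal_numeral zero_le_numeral)
      then show ?thesis using False by (auto simp: indicator_def add_increasing intro: order_trans)
    qed
  qed
  also have "\<dots> = ennreal (1 / (2 - \<beta>)) + 2 * ennreal (1 / \<beta>)"
    by (subst nn_integral_add) (auto simp: nn_integral_cmult 1 2)
  also have "\<dots> < \<infinity>" by (simp add: ennreal_mult_less_top)
  finally show ?thesis .
qed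

lemma levy_integral:
  assumes "0 < \<beta>"
  shows "(\<integral>\<^sup>+r\<in>{0<..}. ennreal ((1 - cos (r * u)) * r powr (- 1 - \<beta>)) \<partial>lborel) =
    ennreal (\<bar>u\<bar> powr \<beta>) * levy_const \<beta>"
proof (cases "u = 0")
  case False
  define v where "v = \<bar>u\<bar>"
  have v: "v > 0" using False by (simp add: v_def)
  have cosv: "cos (r * u) = cos (r * v)" for r
    by (auto simp: v_def abs_if)
  have "levy_const \<beta> = (\<integral>\<^sup>+r. ennreal ((1 - cos r) * r powr (- 1 - \<beta>)) * indicator {0<..} r
      \<partial>density (distr lborel borel (\<lambda>x. 0 + v * x)) (\<lambda>_. ennreal \<bar>v\<bar>))"
    unfolding levy_const_def using v by (subst lborel_real_affine[of v 0]) auto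
  also have "\<dots> = ennreal v * (\<integral>\<^sup>+r. ennreal ((1 - cos (v * r)) * (v * r) powr (- 1 - \<beta>)) * indicator {0<..} (v * r) \<partial>lborel)"
    using v by (simp add: nn_integral_density nn_integral_distr nn_integral_cmult)
  also have "\<dots> = ennreal v * (\<integral>\<^sup>+r. ennreal (v powr (- 1 - \<beta>)) *
     (ennreal ((1 - cos (r * u)) * r powr (- 1 - \<beta>)) * indicator {0<..} r) \<partial>lborel)"
  proof (intro arg_cong[where f="\<lambda>x. ennreal v * x"] nn_integral_cong)
    fix r :: real
    show "ennreal ((1 - cos (v * r)) * (v * r) powr (- 1 - \<beta>)) * indicator {0<..} (v * r) =
      ennreal (v powr (- 1 - \<beta>)) * (ennreal ((1 - cos (r * u)) * r powr (- 1 - \<beta>)) * indicator {0<..} r)"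
    proof (cases "r > 0")
      case True
      then show ?thesis
        using v by (simp add: cosv powr_mult mult_ac flip: ennreal_mult')
    next
      case False
      then show ?thesis using v by (simp add: zero_less_mult_iff)
    qed
  qed
  also have "\<dots> = ennreal (v powr (- \<beta>)) *
      (\<integral>\<^sup>+r\<in>{0<..}. ennreal ((1 - cos (r * u)) * r powr (- 1 - \<beta>)) \<partial>lborel)"
  proof -
    have "v * v powr (- 1 - \<beta>) = v powr (- \<beta>)"
      using v powr_add[of v 1 "- 1 - \<beta>"] by simp
    then show ?thesis
      by (subst nn_integral_cmult) (use v in \<open>auto simp: mult.assoc[symmetric] simp flip: ennreal_mult''\<close>)
  qed
  finally have *: "levy_const \<beta> = ennreal (v powr (- \<beta>)) *
      (\<integral>\<^sup>+r\<in>{0<..}. ennreal ((1 - cos (r * u)) * r powr (- 1 - \<beta>)) \<partial>lborel)" .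
  have "v powr \<beta> * v powr (- \<beta>) = 1" using v by (simp flip: powr_add)
  then show ?thesis
    unfolding * v_def[symmetric] by (simp add: mult.assoc[symmetric] flip: ennreal_mult'')
qed (use assms in simp)

section \<open>Integrability of stretched exponentials by dyadic balls\<close>

lemma summable_exp_powr_geometric:
  fixes c \<beta> :: real
  assumes "c > 0" "\<beta> > 0"
  shows "summable (\<lambda>n. exp (- c * (2 ^ n) powr \<beta>) * (2 ^ Suc n) ^ d)"
proof -
  \<comment> \<open>Since \<open>exp y\<close> dominates \<open>y ^ m / fact m\<close>, a choice
    with \<open>m * \<beta> > d + 1\<close> beats the growth of \<open>(2 ^ n) ^ d\<close> and
    leaves a geometric series of ratio 1/2.\<close>
  obtain m :: nat where m: "real m > (real d + 1) / \<beta>" using reals_Archimedean2 by blast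
  have m': "real m * \<beta> > real d + 1" using m assms(2) by (simp add: field_simps)
  show ?thesis
  proof (rule summable_comparison_test')
    show "summable (\<lambda>n. (fact m / c ^ m * 2 ^ d) * (1/2) ^ n :: real)"
      by (intro summable_mult summable_geometric) auto
    fix n :: nat assume "n \<ge> 0"
    define y where "y = c * (2 ^ n) powr \<beta>"
    have y: "y > 0" using assms by (simp add: y_def)
    have "(\<lambda>i. y ^ i / fact i) sums exp y"
      using exp_converges[of y] by (simp add: divide_inverse mult.commute)
    then have "y ^ m / fact m \<le> exp y"
      using sum_le_suminf[of "\<lambda>i. y ^ i / fact i" "{m}"] y by (simp add: sums_iff)
    then have "exp (- y) \<le> fact m / y ^ m"
      using y by (simp add: exp_minus field_simps)
    also have "\<dots> = fact m / c ^ m * 2 powr (- (real n * \<beta> * m))"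
      using assms unfolding y_def
      by (simp add: power_mult_distrib powr_realpow[symmetric] powr_powr powr_minus divide_inverse)
    also have "\<dots> \<le> fact m / c ^ m * 2 powr (- (real n * (real d + 1)))"
      using m' assms by (intro mult_left_mono powr_mono) (auto simp: mult.assoc mult.commute[of \<beta>] intro!: mult_left_mono)
    also have "2 powr (- (real n * (real d + 1))) = (1/2) ^ n * (1 / (2 ^ n) ^ d)"
      by (simp add: powr_minus powr_realpow[symmetric] powr_powr powr_add[symmetric] field_simps)
    finally have "exp (- y) * (2 ^ Suc n) ^ d \<le> fact m / c ^ m * ((1/2) ^ n * (1 / (2 ^ n) ^ d)) * (2 ^ Suc n) ^ d"
      by (intro mult_right_mono) auto
    also have "\<dots> = (fact m / c ^ m * 2 ^ d) * (1/2) ^ n"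
      by (simp add: power_mult_distrib)
    finally show "norm (exp (- c * (2 ^ n) powr \<beta>) * (2 ^ Suc n) ^ d) \<le> (fact m / c ^ m * 2 ^ d) * (1/2) ^ n"
      by (simp add: y_def)
  qed
qed

lemma ex_dyadic:
  fixes r :: real
  assumes "r \<ge> 1"
  shows "\<exists>n. 2 ^ n \<le> r \<and> r < 2 ^ Suc n"
proof -
  have ex: "\<exists>n. r < 2 ^ n" using real_arch_pow[of 2 r] by auto
  define N where "N = (LEAST n. r < 2 ^ n)"
  have N: "r < 2 ^ N" unfolding N_def using ex by (rule LeastI_ex)
  then have "N \<noteq> 0" using assms by (cases N) auto
  then obtain n where n: "N = Suc n" using not0_implies_Suc by blast
  have "\<not> r < 2 ^ n" using not_less_Least[of n "\<lambda>n. r < 2 ^ n"] n N_def by auto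
  with N n show ?thesis by (intro exI[of _ n]) (simp only: not_less simp_thms)
qed

text \<open>Replaces polar coordinates: the full series of weighted ball indicators majorises
  \<open>f\<close> because one suitable term already does. It serves decay at infinity with growing
  balls and a singularity at 0 with shrinking balls; the origin is excused as a null set.\<close>

lemma nn_integral_dyadic_bound:
  fixes f :: "'a::euclidean_space \<Rightarrow> ennreal"
  assumes f: "\<And>x. x \<noteq> 0 \<Longrightarrow> f x \<noteq> 0 \<Longrightarrow> \<exists>n. norm x < \<rho> n \<and> f x \<le> ennreal (a n)"
    and pos: "\<And>n. 0 \<le> \<rho> n" "\<And>n. 0 \<le> a n" and sm: "summable (\<lambda>n. a n * \<rho> n ^ DIM('a))"
  shows "(\<integral>\<^sup>+x. f x \<partial>lborel) < \<infinity>"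
proof -
  have "(\<integral>\<^sup>+x. f x \<partial>lborel) \<le> (\<integral>\<^sup>+x. (\<Sum>n. ennreal (a n) * indicator (ball (0::'a) (\<rho> n)) x) \<partial>lborel)"
  proof (rule nn_integral_mono_AE)
    show "AE x in lborel. f x \<le> (\<Sum>n. ennreal (a n) * indicator (ball (0::'a) (\<rho> n)) x)"
      using AE_lborel_singleton[of "0::'a"]
    proof eventually_elim
      case (elim x)
      show ?case
      proof (cases "f x = 0")
        case False
        then obtain n where n: "norm x < \<rho> n" "f x \<le> ennreal (a n)" using f elim by blast
        define h :: "nat \<Rightarrow> ennreal" where "h n = ennreal (a n) * indicator (ball (0::'a) (\<rho> n)) x" for n
        have "f x \<le> h n" unfolding h_def using n by (simp add: dist_norm)
        also have "h n \<le> (\<Sum>n. h n)"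
          using sum_le_suminf[of h "{n}"] by simp
        finally show ?thesis unfolding h_def .
      qed simp
    qed
  qed
  also have "\<dots> = (\<Sum>n. ennreal (a n) * emeasure lborel (ball (0::'a) (\<rho> n)))"
  proof (subst nn_integral_suminf)
    have [measurable]: "ball (0::'a) (\<rho> n) \<in> sets borel" for n by simp
    show "(\<lambda>x. ennreal (a n) * indicator (ball (0::'a) (\<rho> n)) x) \<in> borel_measurable lborel" for n
      by measurable
    show "(\<Sum>n. \<integral>\<^sup>+x. ennreal (a n) * indicator (ball (0::'a) (\<rho> n)) x \<partial>lborel) =
        (\<Sum>n. ennreal (a n) * emeasure lborel (ball (0::'a) (\<rho> n)))"
      by (simp add: nn_integral_cmult)
  qed
  also have "\<dots> = (\<Sum>n. ennreal (unit_ball_vol (DIM('a)) * (a n * \<rho> n ^ DIM('a))))"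
    using pos by (simp add: emeasure_ball mult_ac flip: ennreal_mult')
  also have "\<dots> < \<infinity>"
    using sm pos by (subst suminf_ennreal2) (auto intro!: summable_mult mult_nonneg_nonneg)
  finally show ?thesis .
qed

lemma integrable_exp_norm_powr:
  fixes c \<beta> :: real
  assumes "c > 0" "\<beta> > 0"
  shows "integrable lborel (\<lambda>\<xi>::'a::euclidean_space. exp (- c * norm \<xi> powr \<beta>))"
proof (rule integrableI_bounded)
  \<comment> \<open>Index 0 covers the unit ball with bound 1; index \<open>Suc n\<close> covers the
    shell between radii \<open>2 ^ n\<close> and \<open>2 ^ Suc n\<close>, with the value at its
    inner radius as bound.\<close>
  let ?a = "\<lambda>n. case n of 0 \<Rightarrow> 1 | Suc n \<Rightarrow> exp (- c * (2 ^ n) powr \<beta>)"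
  have "(\<integral>\<^sup>+\<xi>. ennreal (exp (- c * norm (\<xi>::'a) powr \<beta>)) \<partial>lborel) < \<infinity>"
  proof (rule nn_integral_dyadic_bound[where a = ?a and \<rho> = "\<lambda>n. 2 ^ n"])
    fix x :: 'a
    show "\<exists>n. norm x < 2 ^ n \<and> ennreal (exp (- c * norm x powr \<beta>)) \<le> ennreal (?a n)"
    proof (cases "norm x < 1")
      case True
      then show ?thesis using assms by (intro exI[of _ 0]) auto
    next
      case False
      then obtain n where n: "2 ^ n \<le> norm x" "norm x < 2 ^ Suc n" using ex_dyadic[of "norm x"] by auto
      then have "exp (- c * norm x powr \<beta>) \<le> exp (- c * (2 ^ n) powr \<beta>)"
        using assms by (auto intro!: powr_mono2)
      then show ?thesis using n(2) by (intro exI[of _ "Suc n"]) (auto intro!: ennreal_leI)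
    qed
    show "summable (\<lambda>n. ?a n * (2 ^ n) ^ DIM('a))"
      by (subst summable_Suc_iff[symmetric]) (use summable_exp_powr_geometric[OF assms, of "DIM('a)"] in simp)
  qed (auto split: nat.split)
  then show "(\<integral>\<^sup>+\<xi>. ennreal (norm (exp (- c * norm (\<xi>::'a) powr \<beta>))) \<partial>lborel) < \<infinity>" by simp
qed auto

section \<open>The stable symbol and its truncated Levy measures\<close>

locale stable_symbol =
  fixes \<beta> :: real and \<nu> :: "'a::euclidean_space measure"
  assumes \<beta>: "0 < \<beta>" "\<beta> < 2" and spectral: "spectral_measure \<beta> \<nu>"
begin

sublocale finite_measure \<nu>
  using spectral by (simp add: spectral_measure_def)

lemma sets_nu: "sets \<nu> = sets (restrict_space borel (sphere 0 1))"
  using spectral by (auto simp: spectral_measure_def sphere_measure_def)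

lemma space_nu: "space \<nu> = sphere 0 1"
  using sets_eq_imp_space_eq[OF sets_nu] by (simp add: space_restrict_space)

lemma measurable_nu_ident: "(\<lambda>x. x) \<in> borel_measurable \<nu>"
  by (subst measurable_cong_sets[OF sets_nu refl]) (auto intro: measurable_restrict_space1)

lemma measurable_fst_nu [measurable]: "fst \<in> borel_measurable (\<nu> \<Otimes>\<^sub>M M)"
  using measurable_compose[OF measurable_fst measurable_nu_ident] .

lemma measurable_snd_nu [measurable]: "snd \<in> borel_measurable (M \<Otimes>\<^sub>M \<nu>)"
  using measurable_compose[OF measurable_snd measurable_nu_ident] .

lemma integrable_nu: "integrable \<nu> (\<lambda>\<eta>. \<bar>\<xi> \<bullet> \<eta>\<bar> powr \<beta>)"
proof (rule integrable_const_bound[where B = "norm \<xi> powr \<beta>"])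
  have "\<bar>\<xi> \<bullet> \<eta>\<bar> powr \<beta> \<le> norm \<xi> powr \<beta>" if "\<eta> \<in> sphere 0 1" for \<eta>
    using Cauchy_Schwarz_ineq2[of \<xi> \<eta>] that \<beta> by (intro powr_mono2) auto
  then show "AE \<eta> in \<nu>. norm (\<bar>\<xi> \<bullet> \<eta>\<bar> powr \<beta>) \<le> norm \<xi> powr \<beta>"
    by (intro AE_I2) (auto simp: space_nu)
  note [measurable] = measurable_nu_ident
  show "(\<lambda>\<eta>. \<bar>\<xi> \<bullet> \<eta>\<bar> powr \<beta>) \<in> borel_measurable \<nu>" by measurable
qed

text \<open>Homogeneity absorbs the norm, so the division by \<open>norm \<xi>\<close> disappears
  and the symbol becomes an integral over directions to which the radial Levy identity
  applies.\<close>

lemma psi_eq: "psi \<beta> \<nu> \<xi> = (\<integral>\<eta>. \<bar>\<xi> \<bullet> \<eta>\<bar> powr \<beta> \<partial>\<nu>)"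
proof (cases "\<xi> = 0")
  case False
  have "norm \<xi> powr \<beta> * \<bar>(\<xi> /\<^sub>R norm \<xi>) \<bullet> \<eta>\<bar> powr \<beta> = \<bar>\<xi> \<bullet> \<eta>\<bar> powr \<beta>" for \<eta>
    using False by (simp add: abs_mult powr_mult[symmetric] mult.assoc[symmetric])
  then show ?thesis
    unfolding psi_def omega_def by (simp only: integral_mult_right_zero[symmetric])
qed (use \<beta> in \<open>simp add: psi_def\<close>)

lemma borel_measurable_psi: "psi \<beta> \<nu> \<in> borel_measurable borel"
proof -
  have "(\<lambda>\<xi>. \<integral>\<eta>. \<bar>\<xi> \<bullet> \<eta>\<bar> powr \<beta> \<partial>\<nu>) \<in> borel_measurable borel" by measurable
  then show ?thesis by (simp add: psi_eq[abs_def])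
qed

lemma measurable_psi [measurable (raw)]:
  "h \<in> borel_measurable M \<Longrightarrow> (\<lambda>x. psi \<beta> \<nu> (h x)) \<in> borel_measurable M"
  by (rule measurable_compose[OF _ borel_measurable_psi])

lemma ennreal_psi: "ennreal (psi \<beta> \<nu> \<xi>) = (\<integral>\<^sup>+\<eta>. ennreal (\<bar>\<xi> \<bullet> \<eta>\<bar> powr \<beta>) \<partial>\<nu>)"
  unfolding psi_eq by (rule nn_integral_eq_integral[symmetric, OF integrable_nu]) simp

lemma psi_nonneg: "0 \<le> psi \<beta> \<nu> \<xi>"
  unfolding psi_eq by simp

lemma psi_scaleR: "psi \<beta> \<nu> (c *\<^sub>R \<xi>) = \<bar>c\<bar> powr \<beta> * psi \<beta> \<nu> \<xi>"
  unfolding psi_eq by (simp add: abs_mult powr_mult)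

text \<open>The smooth extension of \<open>omega\<close> is continuous on the compact sphere, so
  \<open>omega\<close> attains a minimum there, positive by the spectral assumption; homogeneity
  spreads the bound to all \<xi>.\<close>

lemma psi_lower_bound: "\<exists>c>0. \<forall>\<xi>. c * norm \<xi> powr \<beta> \<le> psi \<beta> \<nu> \<xi>"
proof -
  obtain U F where U: "open U" "sphere 0 1 \<subseteq> U" and F: "times_cont_diff_on (DIM('a) + 1 + nat \<lfloor>\<beta>\<rfloor>) F U"
    "\<And>\<theta>. \<theta> \<in> sphere 0 1 \<Longrightarrow> F \<theta> = omega \<beta> \<nu> \<theta>"
    using spectral by (auto simp: spectral_measure_def sphere_times_cont_diff_def)
  have "\<And>x. x \<in> U \<Longrightarrow> F differentiable (at x)" using F(1) by simp
  then have "continuous_on (sphere 0 1) F"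
    using U(2) by (intro continuous_at_imp_continuous_on ballI differentiable_imp_continuous_within) blast
  moreover have "sphere (0::'a) 1 \<noteq> {}" by simp
  ultimately obtain \<theta> where \<theta>: "\<theta> \<in> sphere 0 1" "\<And>\<eta>. \<eta> \<in> sphere 0 1 \<Longrightarrow> F \<theta> \<le> F \<eta>"
    using continuous_attains_inf[of "sphere (0::'a) 1" F] by auto
  have "omega \<beta> \<nu> \<theta> > 0" using spectral \<theta>(1) by (simp add: spectral_measure_def)
  moreover have "omega \<beta> \<nu> \<theta> * norm \<xi> powr \<beta> \<le> psi \<beta> \<nu> \<xi>" for \<xi>
  proof (cases "\<xi> = 0")
    case False
    then have "\<xi> /\<^sub>R norm \<xi> \<in> sphere 0 1" by simp
    from \<theta>(2)[OF this] this have "omega \<beta> \<nu> \<theta> \<le> omega \<beta> \<nu> (\<xi> /\<^sub>R norm \<xi>)"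
      using F(2) \<theta>(1) by simp
    then show ?thesis
      unfolding psi_def mult.commute[of "omega \<beta> \<nu> \<theta>"] by (rule mult_left_mono) simp
  qed (simp add: psi_def)
  ultimately show ?thesis by (intro exI[of _ "omega \<beta> \<nu> \<theta>"]) simp
qed

lemma integrable_exp_psi:
  assumes "\<tau> > 0"
  shows "integrable lborel (\<lambda>\<xi>. exp (- \<tau> * psi \<beta> \<nu> \<xi>))"
proof -
  obtain c where c: "c > 0" "\<And>\<xi>. c * norm \<xi> powr \<beta> \<le> psi \<beta> \<nu> \<xi>" using psi_lower_bound by blast
  show ?thesis
  proof (rule Bochner_Integration.integrable_bound)
    show "integrable lborel (\<lambda>\<xi>::'a. exp (- (\<tau> * c) * norm \<xi> powr \<beta>))"
      using c assms \<beta> by (intro integrable_exp_norm_powr) auto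
    show "AE \<xi> in lborel. norm (exp (- \<tau> * psi \<beta> \<nu> \<xi>)) \<le> norm (exp (- (\<tau> * c) * norm \<xi> powr \<beta>))"
      using c(2) assms by (intro AE_I2) (simp add: mult.assoc)
  qed measurable
qed

text \<open>The Levy measure of the stable law, cut off to radii between \<open>1 / (n + 1)\<close> and \<open>n + 1\<close>;
  its characteristic exponent increases to a multiple of \<open>psi\<close>.\<close>

definition cut_levy :: "nat \<Rightarrow> ('a \<times> real) measure" where
  "cut_levy n = density (\<nu> \<Otimes>\<^sub>M lborel)
     (\<lambda>(\<eta>, r). ennreal (r powr (- 1 - \<beta>)) * indicator {1 / (real n + 1)..real n + 1} r)"

lemma finite_measure_cut_levy: "finite_measure (cut_levy n)"
proof (rule finite_measureI)
  let ?a = "1 / (real n + 1)"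
  have a: "?a > 0" by simp
  have "emeasure (cut_levy n) (space (cut_levy n)) = (\<integral>\<^sup>+p. 1 \<partial>cut_levy n)" by simp
  also have "\<dots> = (\<integral>\<^sup>+(\<eta>, r). ennreal (r powr (- 1 - \<beta>)) *
      indicator {?a..real n + 1} r \<partial>(\<nu> \<Otimes>\<^sub>M lborel))"
    unfolding cut_levy_def by (subst nn_integral_density) (simp_all add: split_beta')
  also have "\<dots> = (\<integral>\<^sup>+\<eta>. (\<integral>\<^sup>+r. ennreal (r powr (- 1 - \<beta>)) * indicator {?a..real n + 1} r \<partial>lborel) \<partial>\<nu>)"
    by (subst lborel.nn_integral_fst[symmetric]) auto
  also have "\<dots> \<le> (\<integral>\<^sup>+\<eta>. (\<integral>\<^sup>+r. ennreal (?a powr (- 1 - \<beta>)) * indicator {?a..real n + 1} r \<partial>lborel) \<partial>\<nu>)"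
    using \<beta> a by (intro nn_integral_mono) (auto simp: indicator_def intro!: ennreal_leI powr_mono2')
  also have "\<dots> = ennreal (?a powr (- 1 - \<beta>)) * emeasure lborel {?a..real n + 1} * emeasure \<nu> (space \<nu>)"
    by (simp add: nn_integral_cmult)
  also have "\<dots> < \<infinity>"
    by (auto simp: ennreal_mult_less_top emeasure_eq_measure emeasure_lborel_Icc_eq)
  finally show "emeasure (cut_levy n) (space (cut_levy n)) \<noteq> \<infinity>" by simp
qed

lemma measurable_cut_levy [measurable]: "(\<lambda>p. snd p *\<^sub>R fst p) \<in> borel_measurable (cut_levy n)"
  unfolding cut_levy_def by measurable

text \<open>Monotone convergence and Tonelli in \<open>[0, \<infinity>]\<close> reduce the limit to
  \<open>levy_integral\<close> with \<open>u = \<xi> \<bullet> \<eta>\<close>; integrating over the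
  directions \<eta> then gives \<open>psi\<close>.\<close>

lemma cut_levy_tendsto:
  "(\<lambda>n. \<integral>p. 1 - cos ((snd p *\<^sub>R fst p) \<bullet> \<xi>) \<partial>cut_levy n) \<longlonglongrightarrow> enn2real (levy_const \<beta>) * psi \<beta> \<nu> \<xi>"
proof -
  define c where "c = enn2real (levy_const \<beta>)"
  have c: "levy_const \<beta> = ennreal c" "c \<ge> 0"
    using levy_const_finite[OF \<beta>] by (simp_all add: c_def less_top)
  define h where "h r \<eta> = ennreal ((1 - cos (r * (\<xi> \<bullet> \<eta>))) * r powr (- 1 - \<beta>))" for r \<eta>
  have [measurable]: "(\<lambda>p. h (snd p) (fst p)) \<in> borel_measurable (\<nu> \<Otimes>\<^sub>M lborel)"
    unfolding h_def by measurable
  have [measurable]: "(\<lambda>r. h r \<eta>) \<in> borel_measurable borel" for \<eta>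
    unfolding h_def by measurable
  have [measurable]: "(\<lambda>\<eta>. \<bar>\<xi> \<bullet> \<eta>\<bar> powr \<beta>) \<in> borel_measurable \<nu>"
    using integrable_nu by blast
  let ?I = "\<lambda>n. {1 / (real n + 1)..real n + 1}"
  have "(\<lambda>n. \<integral>\<^sup>+p. h (snd p) (fst p) * indicator (?I n) (snd p) \<partial>(\<nu> \<Otimes>\<^sub>M lborel))
    \<longlonglongrightarrow> (\<integral>\<^sup>+p. h (snd p) (fst p) * indicator {0<..} (snd p) \<partial>(\<nu> \<Otimes>\<^sub>M lborel))"
  proof (rule nn_integral_LIMSEQ)
    have sub: "?I m \<subseteq> ?I n" if "m \<le> n" for m n
    proof -
      have "1 / (real n + 1) \<le> 1 / (real m + 1)" using that by (intro frac_le) auto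
      then show ?thesis using that by auto
    qed
    show "incseq (\<lambda>n p. h (snd p) (fst p) * indicator (?I n) (snd p))"
      unfolding incseq_def le_fun_def
    proof (intro allI impI mult_left_mono)
      show "indicator (?I m) (snd p) \<le> (indicator (?I n) (snd p) :: ennreal)" if "m \<le> n" for m n p
        using subsetD[OF sub[OF that]] by (intro indicator_leI)
    qed auto
    show "(\<lambda>n. h (snd p) (fst p) * indicator (?I n) (snd p)) \<longlonglongrightarrow> h (snd p) (fst p) * indicator {0<..} (snd p)" for p
    proof (cases "snd p > 0")
      case True
      obtain N where N: "real N \<ge> max (snd p) (1 / snd p)" using real_arch_simple by blast
      have "snd p \<in> ?I n" if "n \<ge> N" for n
      proof -
        have n: "snd p \<le> real n + 1" "1 / snd p \<le> real n + 1" using N that by linarith+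
        then show ?thesis using True by (simp add: field_simps)
      qed
      then have "eventually (\<lambda>n. h (snd p) (fst p) * indicator {0<..} (snd p) =
          h (snd p) (fst p) * indicator (?I n) (snd p)) sequentially"
        using True by (intro eventually_sequentiallyI[of N]) auto
      then show ?thesis by (rule tendsto_eventually[THEN Lim_transform_eventually, rotated]) (auto intro: tendsto_eventually)
    next
      case False
      then have "snd p \<notin> ?I n" for n using divide_pos_pos[of 1 "real n + 1"] by (auto simp: not_less dest: order_trans)
      then show ?thesis using False by simp
    qed
  qed auto
  also have "(\<integral>\<^sup>+p. h (snd p) (fst p) * indicator {0<..} (snd p) \<partial>(\<nu> \<Otimes>\<^sub>M lborel)) =
      (\<integral>\<^sup>+\<eta>. (\<integral>\<^sup>+r. h r \<eta> * indicator {0<..} r \<partial>lborel) \<partial>\<nu>)"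
    by (subst lborel.nn_integral_fst[symmetric]) auto
  also have "\<dots> = (\<integral>\<^sup>+\<eta>. ennreal (\<bar>\<xi> \<bullet> \<eta>\<bar> powr \<beta>) * levy_const \<beta> \<partial>\<nu>)"
    unfolding h_def levy_integral[OF \<beta>(1)] ..
  also have "\<dots> = ennreal (c * psi \<beta> \<nu> \<xi>)"
    using c(2) psi_nonneg by (subst nn_integral_multc) (auto simp: c(1) ennreal_psi[symmetric] ennreal_mult mult.commute)
  also have "(\<lambda>n. \<integral>\<^sup>+p. h (snd p) (fst p) * indicator (?I n) (snd p) \<partial>(\<nu> \<Otimes>\<^sub>M lborel)) =
      (\<lambda>n. ennreal (\<integral>p. 1 - cos ((snd p *\<^sub>R fst p) \<bullet> \<xi>) \<partial>cut_levy n))"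
  proof
    fix n
    interpret cut: finite_measure "cut_levy n" by (rule finite_measure_cut_levy)
    have "ennreal (\<integral>p. 1 - cos ((snd p *\<^sub>R fst p) \<bullet> \<xi>) \<partial>cut_levy n) =
        (\<integral>\<^sup>+p. ennreal (1 - cos ((snd p *\<^sub>R fst p) \<bullet> \<xi>)) \<partial>cut_levy n)"
    proof (rule nn_integral_eq_integral[symmetric])
      have "\<bar>1 - cos x\<bar> \<le> 2" for x :: real using cos_le_one[of x] cos_ge_minus_one[of x] by linarith
      then show "integrable (cut_levy n) (\<lambda>p. 1 - cos ((snd p *\<^sub>R fst p) \<bullet> \<xi>))"
        by (intro cut.integrable_const_bound[where B=2]) (simp, measurable)
    qed auto
    also have "\<dots> = (\<integral>\<^sup>+p. h (snd p) (fst p) * indicator (?I n) (snd p) \<partial>(\<nu> \<Otimes>\<^sub>M lborel))"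
      unfolding cut_levy_def
      by (subst nn_integral_density)
        (auto intro!: nn_integral_cong simp: h_def inner_commute ennreal_mult' mult_ac)
    finally show "(\<integral>\<^sup>+p. h (snd p) (fst p) * indicator (?I n) (snd p) \<partial>(\<nu> \<Otimes>\<^sub>M lborel)) =
      ennreal (\<integral>p. 1 - cos ((snd p *\<^sub>R fst p) \<bullet> \<xi>) \<partial>cut_levy n)" by simp
  qed
  finally show ?thesis
    using c(2) psi_nonneg by (subst (asm) tendsto_ennreal_iff) (auto simp: c_def)
qed

lemma gauss_posdef_exp_psi:
  assumes "\<tau> > 0"
  shows "gauss_posdef (\<lambda>\<xi>. exp (- \<tau> * psi \<beta> \<nu> \<xi>))"
proof -
  define c where "c = enn2real (levy_const \<beta>)"
  have c: "c > 0"
    using levy_const_finite[OF \<beta>] levy_const_pos[of \<beta>] by (simp add: c_def enn2real_positive_iff)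
  show ?thesis
  proof (rule gauss_posdef_limit)
    \<comment> \<open>The intensity \<open>\<tau> / c\<close> cancels the constant \<open>c\<close>
      that the truncated exponents acquire in the limit.\<close>
    show "gauss_posdef (\<lambda>\<xi>. exp (- (\<tau> / c) * (\<integral>p. 1 - cos ((snd p *\<^sub>R fst p) \<bullet> \<xi>) \<partial>cut_levy n)))" for n
      using assms c by (intro gauss_posdef_exp_cos_transform finite_measure_cut_levy) auto
    show "\<bar>exp (- (\<tau> / c) * (\<integral>p. 1 - cos ((snd p *\<^sub>R fst p) \<bullet> \<xi>) \<partial>cut_levy n))\<bar> \<le> 1" for n \<xi>
      using assms c by (auto intro!: mult_nonneg_nonneg Bochner_Integration.integral_nonneg)
    have "(\<lambda>n. exp (- (\<tau> / c) * (\<integral>p. 1 - cos ((snd p *\<^sub>R fst p) \<bullet> \<xi>) \<partial>cut_levy n))) \<longlonglongrightarrow>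
        exp (- (\<tau> / c) * (c * psi \<beta> \<nu> \<xi>))" for \<xi>
      unfolding c_def by (intro tendsto_intros cut_levy_tendsto)
    then show "(\<lambda>n. exp (- (\<tau> / c) * (\<integral>p. 1 - cos ((snd p *\<^sub>R fst p) \<bullet> \<xi>) \<partial>cut_levy n))) \<longlonglongrightarrow>
        exp (- \<tau> * psi \<beta> \<nu> \<xi>)" for \<xi>
      using c by simp
  qed
qed

end

section \<open>Bounds for the kernels\<close>

lemma borel_measurable_cis [measurable]: "cis \<in> borel_measurable borel"
  by (intro borel_measurable_continuous_onI continuous_intros)

section \<open>Positivity, scaling and lower bound of the stable kernel\<close>

context stable_symbol
begin

lemma G_eq:
  assumes "\<tau> > 0"
  shows "G \<beta> \<nu> \<tau> x = (\<integral>\<xi>. cos (x \<bullet> \<xi>) * exp (- \<tau> * psi \<beta> \<nu> \<xi>) \<partial>lborel) / (2 * pi) ^ DIM('a)"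
proof -
  have "integrable lborel (\<lambda>\<xi>. cis (x \<bullet> \<xi>) * of_real (exp (- \<tau> * psi \<beta> \<nu> \<xi>)))"
    by (rule Bochner_Integration.integrable_bound[OF integrable_exp_psi[OF assms]])
      (auto simp: norm_mult)
  from integral_Re[OF this] show ?thesis
    unfolding G_def by simp
qed

lemma G_nonneg: "\<tau> > 0 \<Longrightarrow> 0 \<le> G \<beta> \<nu> \<tau> x"
  unfolding G_eq
  by (intro divide_nonneg_pos gauss_posdef_fourier_nonneg gauss_posdef_exp_psi integrable_exp_psi) auto

lemma measurable_G [measurable (raw)]:
  assumes [measurable]: "h \<in> borel_measurable M" "y \<in> borel_measurable M"
  shows "(\<lambda>p. G \<beta> \<nu> (h p) (y p)) \<in> borel_measurable M"
  unfolding G_def by measurable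

lemma G_scale:
  assumes "\<tau> > 0"
  shows "G \<beta> \<nu> \<tau> x = \<tau> powr (- real DIM('a) / \<beta>) * G \<beta> \<nu> 1 (x /\<^sub>R \<tau> powr (1 / \<beta>))"
proof -
  define c where "c = \<tau> powr (1 / \<beta>)"
  have c: "c > 0" "c powr \<beta> = \<tau>" using assms \<beta> by (simp_all add: c_def powr_powr)
  have cd: "\<tau> powr (- real DIM('a) / \<beta>) = 1 / c ^ DIM('a)"
    using assms by (simp add: c_def powr_realpow[symmetric] powr_powr powr_minus_divide)
  have "(\<integral>\<xi>. cos ((x /\<^sub>R c) \<bullet> (c *\<^sub>R \<xi>)) * exp (- 1 * psi \<beta> \<nu> (c *\<^sub>R \<xi>)) \<partial>lborel) =
    (\<integral>\<xi>. cos ((x /\<^sub>R c) \<bullet> \<xi>) * exp (- 1 * psi \<beta> \<nu> \<xi>) \<partial>lborel) / \<bar>c\<bar> ^ DIM('a)"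
    using c by (intro lborel_integral_scaleR) auto
  moreover have "(x /\<^sub>R c) \<bullet> (c *\<^sub>R \<xi>) = x \<bullet> \<xi>" for \<xi> using c by simp
  moreover have "psi \<beta> \<nu> (c *\<^sub>R \<xi>) = \<tau> * psi \<beta> \<nu> \<xi>" for \<xi> using c by (simp add: psi_scaleR)
  ultimately have "(\<integral>\<xi>. cos (x \<bullet> \<xi>) * exp (- \<tau> * psi \<beta> \<nu> \<xi>) \<partial>lborel) =
    (\<integral>\<xi>. cos ((x /\<^sub>R c) \<bullet> \<xi>) * exp (- 1 * psi \<beta> \<nu> \<xi>) \<partial>lborel) / c ^ DIM('a)"
    using c by (simp only: abs_of_pos mult_minus_left mult_1)
  then show ?thesis
    unfolding G_eq[OF assms] G_eq[OF zero_less_one] cd c_def[symmetric] by simp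
qed

text \<open>At time 1 the kernel is continuous, and at the origin it is the integral of a positive
  function; hence it stays above half that value on a small ball, and scaling carries the ball to
  every time.\<close>

lemma G_lower_bound:
  "\<exists>c>0. \<exists>\<delta>>0. \<forall>\<tau>>0. \<forall>x. norm x \<le> \<delta> * \<tau> powr (1 / \<beta>) \<longrightarrow> c * \<tau> powr (- real DIM('a) / \<beta>) \<le> G \<beta> \<nu> \<tau> x"
proof -
  have "isCont (G \<beta> \<nu> 1) 0"
    unfolding continuous_at_sequentially
  proof (intro allI impI)
    fix u :: "nat \<Rightarrow> 'a" assume u: "u \<longlonglongrightarrow> 0"
    have "(\<lambda>n. \<integral>\<xi>. cos (u n \<bullet> \<xi>) * exp (- 1 * psi \<beta> \<nu> \<xi>) \<partial>lborel) \<longlonglongrightarrow>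
        (\<integral>\<xi>. cos (0 \<bullet> \<xi>) * exp (- 1 * psi \<beta> \<nu> \<xi>) \<partial>lborel)"
    proof (rule integral_dominated_convergence)
      show "integrable lborel (\<lambda>\<xi>. exp (- 1 * psi \<beta> \<nu> \<xi>))" by (rule integrable_exp_psi) simp
      show "AE \<xi> in lborel. (\<lambda>n. cos (u n \<bullet> \<xi>) * exp (- 1 * psi \<beta> \<nu> \<xi>)) \<longlonglongrightarrow> cos (0 \<bullet> \<xi>) * exp (- 1 * psi \<beta> \<nu> \<xi>)"
        by (intro AE_I2 tendsto_intros u)
    qed (auto simp: abs_mult mult_left_le_one_le)
    then show "(G \<beta> \<nu> 1 \<circ> u) \<longlonglongrightarrow> G \<beta> \<nu> 1 0"
      unfolding comp_def G_eq[OF zero_less_one] by (intro tendsto_divide tendsto_const) auto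
  qed
  moreover have pos: "G \<beta> \<nu> 1 0 > 0"
  proof -
    have "0 < (\<integral>\<xi>. exp (- 1 * psi \<beta> \<nu> \<xi>) \<partial>lborel)"
    proof (rule ccontr)
      assume "\<not> ?thesis"
      moreover have "0 \<le> (\<integral>\<xi>. exp (- 1 * psi \<beta> \<nu> \<xi>) \<partial>lborel)" by (rule Bochner_Integration.integral_nonneg) simp
      ultimately have "(\<integral>\<xi>. exp (- 1 * psi \<beta> \<nu> \<xi>) \<partial>lborel) = 0" by linarith
      then have "AE \<xi> in lborel. exp (- 1 * psi \<beta> \<nu> \<xi>) = 0"
        by (subst (asm) integral_nonneg_eq_0_iff_AE[OF integrable_exp_psi]) auto
      then have "AE \<xi> in (lborel :: 'a measure). False" by eventually_elim simp
      then show False by (simp add: eventually_False ae_filter_eq_bot_iff)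
    qed
    then show ?thesis by (simp add: G_eq)
  qed
  ultimately have "eventually (\<lambda>x. G \<beta> \<nu> 1 x > G \<beta> \<nu> 1 0 / 2) (at 0)"
    by (intro order_tendstoD(1)[of _ "G \<beta> \<nu> 1 0"]) (auto simp: isCont_def)
  then obtain d where d: "d > 0" "\<And>x. x \<noteq> 0 \<Longrightarrow> norm x < d \<Longrightarrow> G \<beta> \<nu> 1 x > G \<beta> \<nu> 1 0 / 2"
    by (auto simp: eventually_at dist_norm)
  \<comment> \<open>The neighbourhood filter omits its centre, hence the separate case
    \<open>x = 0\<close>; halving the radius gives a closed ball.\<close>
  have d': "G \<beta> \<nu> 1 0 / 2 \<le> G \<beta> \<nu> 1 x" if "norm x \<le> d / 2" for x
    using d(2)[of x] that d(1) pos by (cases "x = 0") auto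
  have "G \<beta> \<nu> 1 0 / 2 * \<tau> powr (- real DIM('a) / \<beta>) \<le> G \<beta> \<nu> \<tau> x"
    if "\<tau> > 0" "norm x \<le> d / 2 * \<tau> powr (1 / \<beta>)" for \<tau> x
  proof -
    have "norm (x /\<^sub>R \<tau> powr (1 / \<beta>)) \<le> d / 2" using that by (simp add: field_simps)
    from mult_left_mono[OF d'[OF this], of "\<tau> powr (- real DIM('a) / \<beta>)"] show ?thesis
      unfolding G_scale[OF that(1), of x] by (simp only: mult.commute powr_ge_zero)
  qed
  then show ?thesis using pos d(1) by (intro exI[of _ "G \<beta> \<nu> 1 0 / 2"] conjI exI[of _ "d / 2"]) auto
qed

text \<open>Fubini moves the Fourier transform onto the Gaussian, leaving
  \<open>exp (- \<tau> * psi \<beta> \<nu> \<xi>) \<le> 1\<close> against a Gaussian; hence the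
  bound is the same for all \<tau>. It stands in for the total mass of the kernel.\<close>

lemma G_gaussian_integral_bound:
  "\<exists>K\<ge>0. \<forall>\<tau>>0. (\<integral>\<^sup>+x. ennreal (G \<beta> \<nu> \<tau> x * exp (- (norm x)\<^sup>2 / 2)) \<partial>lborel) \<le> ennreal K"
proof -
  let ?e = "\<lambda>x::'a. exp (- (norm x)\<^sup>2 / 2)"
  have ge: "integrable lborel ?e" using integrable_gaussian[of 1, where 'a='a] by simp
  define K where "K = sqrt (2 * pi) ^ DIM('a) * (\<integral>x. ?e x \<partial>lborel) / (2 * pi) ^ DIM('a)"
  have "(\<integral>\<^sup>+x. ennreal (G \<beta> \<nu> \<tau> x * ?e x) \<partial>lborel) \<le> ennreal K" if \<tau>: "\<tau> > 0" for \<tau>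
  proof -
    let ?p = "\<lambda>\<xi>. exp (- \<tau> * psi \<beta> \<nu> \<xi>)"
    define h where "h x \<xi> = cos (x \<bullet> \<xi>) * ?p \<xi> * ?e x" for x \<xi> :: 'a
    have [measurable]: "case_prod h \<in> borel_measurable (lborel \<Otimes>\<^sub>M lborel)"
      unfolding h_def by measurable
    have int: "integrable (lborel \<Otimes>\<^sub>M lborel) (case_prod h)"
    proof (rule Bochner_Integration.integrable_bound)
      show "integrable (lborel \<Otimes>\<^sub>M lborel) (\<lambda>(x, \<xi>). ?e x * ?p \<xi>)"
        using ge integrable_exp_psi[OF \<tau>]
        by (intro lborel_pair.Fubini_integrable) (auto simp: abs_mult)
      show "AE z in lborel \<Otimes>\<^sub>M lborel. norm (case_prod h z) \<le> norm (case z of (x, \<xi>) \<Rightarrow> ?e x * ?p \<xi>)"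
        by (auto simp: h_def abs_mult mult_left_le_one_le mult.commute[of "\<bar>cos _\<bar>"] intro!: AE_I2 mult_left_le)
    qed measurable
    have Ge: "G \<beta> \<nu> \<tau> x * ?e x = (\<integral>\<xi>. h x \<xi> \<partial>lborel) / (2 * pi) ^ DIM('a)" for x
      unfolding G_eq[OF \<tau>] h_def by simp
    have "integrable lborel (\<lambda>x. G \<beta> \<nu> \<tau> x * ?e x)"
      unfolding Ge using lborel_pair.integrable_fst'[OF int] by simp
    then have "(\<integral>\<^sup>+x. ennreal (G \<beta> \<nu> \<tau> x * ?e x) \<partial>lborel) = ennreal (\<integral>x. G \<beta> \<nu> \<tau> x * ?e x \<partial>lborel)"
      using G_nonneg[OF \<tau>] by (intro nn_integral_eq_integral) auto
    also have "(\<integral>x. G \<beta> \<nu> \<tau> x * ?e x \<partial>lborel) = (\<integral>x. (\<integral>\<xi>. h x \<xi> \<partial>lborel) \<partial>lborel) / (2 * pi) ^ DIM('a)"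
      unfolding Ge by simp
    also have "(\<integral>x. (\<integral>\<xi>. h x \<xi> \<partial>lborel) \<partial>lborel) = (\<integral>\<xi>. (\<integral>x. h x \<xi> \<partial>lborel) \<partial>lborel)"
      by (rule lborel_pair.Fubini_integral[OF int, symmetric])
    also have "\<dots> = (\<integral>\<xi>. ?p \<xi> * (sqrt (2 * pi) ^ DIM('a) * ?e \<xi>) \<partial>lborel)"
    proof (rule Bochner_Integration.integral_cong[OF refl])
      fix \<xi> :: 'a
      have "(\<integral>x. h x \<xi> \<partial>lborel) = (\<integral>x. ?p \<xi> * (cos (\<xi> \<bullet> x) * ?e x) \<partial>lborel)"
        by (simp add: h_def mult_ac inner_commute)
      also have "\<dots> = ?p \<xi> * (sqrt (2 * pi) ^ DIM('a) * ?e \<xi>)"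
        using gaussian_cos_integral[of 1 \<xi>] by simp
      finally show "(\<integral>x. h x \<xi> \<partial>lborel) = ?p \<xi> * (sqrt (2 * pi) ^ DIM('a) * ?e \<xi>)" .
    qed
    also have "\<dots> \<le> (\<integral>\<xi>. sqrt (2 * pi) ^ DIM('a) * ?e \<xi> \<partial>lborel)"
    proof (rule integral_mono)
      show g: "integrable lborel (\<lambda>\<xi>::'a. sqrt (2 * pi) ^ DIM('a) * ?e \<xi>)" using ge by simp
      have le: "?p \<xi> \<le> 1" for \<xi> using \<tau> psi_nonneg by simp
      show "integrable lborel (\<lambda>\<xi>. ?p \<xi> * (sqrt (2 * pi) ^ DIM('a) * ?e \<xi>))"
        by (rule Bochner_Integration.integrable_bound[OF g])
          (use le in \<open>auto simp: abs_mult intro!: AE_I2 mult_left_le_one_le\<close>)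
      show "?p \<xi> * (sqrt (2 * pi) ^ DIM('a) * ?e \<xi>) \<le> sqrt (2 * pi) ^ DIM('a) * ?e \<xi>" for \<xi>
        using le by (intro mult_left_le_one_le) auto
    qed
    also have "\<dots> / (2 * pi) ^ DIM('a) = K" by (simp add: K_def)
    finally show ?thesis by (simp add: divide_right_mono ennreal_leI)
  qed
  moreover have "K \<ge> 0" unfolding K_def by (intro divide_nonneg_pos mult_nonneg_nonneg Bochner_Integration.integral_nonneg) auto
  ultimately show ?thesis by blast
qed

end

text \<open>Divided by \<alpha>, this is the density of \<open>\<sigma> powr (- \<alpha>)\<close>
  when \<sigma> has the stable density \<open>Ga 1\<close>: the law of the inverse stable
  subordinator at time 1. \<open>Z\<close> is the corresponding mixture of \<open>G\<close> at the
  times \<open>t powr \<alpha> * s\<close>.\<close>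

definition time_change_density :: "real \<Rightarrow> (real \<Rightarrow> real \<Rightarrow> real) \<Rightarrow> real \<Rightarrow> real" where
  "time_change_density \<alpha> Ga s = s powr (- 1 - 1 / \<alpha>) * Ga 1 (s powr (- 1 / \<alpha>))"

lemma measurable_time_change_density:
  assumes "stable_density \<alpha> Ga"
  shows "time_change_density \<alpha> Ga \<in> borel_measurable borel"
proof -
  have [measurable]: "Ga 1 \<in> borel_measurable borel" using assms by (simp add: stable_density_def)
  show ?thesis unfolding time_change_density_def by measurable
qed

lemma time_change_density_nonneg:
  "stable_density \<alpha> Ga \<Longrightarrow> s > 0 \<Longrightarrow> 0 \<le> time_change_density \<alpha> Ga s"
  by (simp add: stable_density_def time_change_density_def)

text \<open>The substitution \<open>s powr (- 1 / \<alpha>)\<close> has Jacobian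
  \<open>s powr (- 1 - 1 / \<alpha>) / \<alpha>\<close>, so the mass 1 of \<open>Ga 1\<close>
  becomes \<alpha>.\<close>

lemma time_change_density_integral:
  assumes "0 < \<alpha>" "stable_density \<alpha> Ga"
  shows "set_integrable lborel {0<..} (time_change_density \<alpha> Ga)"
    and "(LBINT s:{0<..}. time_change_density \<alpha> Ga s) = \<alpha>"
proof -
  let ?g = "\<lambda>s::real. s powr (- 1 / \<alpha>)" and ?g' = "\<lambda>s::real. (- 1 / \<alpha>) * s powr (- 1 / \<alpha> - 1)"
  have [measurable]: "Ga 1 \<in> borel_measurable borel" using assms by (simp add: stable_density_def)
  have sd: "set_integrable lborel {0<..} (\<lambda>s. exp (- \<mu> * s) * Ga 1 s)"
      "(LBINT s:{0<..}. exp (- \<mu> * s) * Ga 1 s) = exp (- 1 * \<mu> powr \<alpha>)" if "\<mu> \<ge> 0" for \<mu>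
    using assms(2) that unfolding stable_density_def by (auto dest!: spec[of _ 1])
  \<comment> \<open>At \<open>\<mu> = 0\<close> the Laplace transform is the total mass, which is 1
    because \<open>0 powr \<alpha> = 0\<close>.\<close>
  have Ga1: "set_integrable lborel {0<..} (Ga 1)" "(LBINT s:{0<..}. Ga 1 s) = 1"
    using sd[of 0] assms(1) by simp_all
  \<comment> \<open>The change of variables formula is used on \<open>lebesgue\<close>, the kernels
    live on \<open>lborel\<close>; Borel functions have the same integrals for both.\<close>
  have leb: "set_integrable lebesgue {0<..} F = set_integrable lborel {0<..} F"
      "(LINT s:{0<..}|lebesgue. F s) = (LBINT s:{0<..}. F s)"
    if [measurable]: "F \<in> borel_measurable borel" for F :: "real \<Rightarrow> real"
    unfolding set_integrable_def set_lebesgue_integral_def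
    by (auto simp: integrable_completion integral_completion)
  have inj: "inj_on ?g {0<..}"
  proof (rule inj_on_inverseI)
    show "(?g s) powr (- \<alpha>) = s" if "s \<in> {0<..}" for s
      using that assms(1) by (simp add: powr_powr)
  qed
  have img: "?g ` {0<..} = {0<..}"
  proof
    show "{0<..} \<subseteq> ?g ` {0<..}"
    proof
      fix s :: real assume "s \<in> {0<..}"
      then have "s = ?g (s powr (- \<alpha>))" "s powr (- \<alpha>) \<in> {0<..}"
        using assms(1) by (simp_all add: powr_powr)
      then show "s \<in> ?g ` {0<..}" by blast
    qed
  qed auto
  have abs': "\<bar>?g' s\<bar> * Ga 1 (?g s) = time_change_density \<alpha> Ga s / \<alpha>" for s
  proof -
    have "\<bar>?g' s\<bar> = s powr (- 1 - 1 / \<alpha>) / \<alpha>"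
      using assms(1) arg_cong[of "- 1 / \<alpha> - 1" "- 1 - 1 / \<alpha>" "\<lambda>p. s powr p"] by (simp add: abs_mult)
    then show ?thesis by (simp add: time_change_density_def)
  qed
  have "Ga 1 absolutely_integrable_on ?g ` {0<..} \<and> integral (?g ` {0<..}) (Ga 1) = 1"
    using Ga1 leb[of "Ga 1"] set_lebesgue_integral_eq_integral(2)[of "{0<..}" "Ga 1"]
    unfolding img by simp
  moreover have "(?g has_field_derivative ?g' s) (at s within {0<..})" if "s \<in> {0<..}" for s
    using that by (auto intro!: derivative_eq_intros)
  ultimately have "(\<lambda>s. \<bar>?g' s\<bar> * Ga 1 (?g s)) absolutely_integrable_on {0<..} \<and>
      integral {0<..} (\<lambda>s. \<bar>?g' s\<bar> * Ga 1 (?g s)) = 1"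
    by (intro iffD2[OF has_absolute_integral_change_of_variables_1'[OF _ _ inj]]) auto
  then have *: "(\<lambda>s. time_change_density \<alpha> Ga s / \<alpha>) absolutely_integrable_on {0<..}"
      "integral {0<..} (\<lambda>s. time_change_density \<alpha> Ga s / \<alpha>) = 1"
    unfolding abs' by auto
  have m: "(\<lambda>s. time_change_density \<alpha> Ga s / \<alpha>) \<in> borel_measurable borel"
    using measurable_time_change_density[OF assms(2)] by measurable
  show "set_integrable lborel {0<..} (time_change_density \<alpha> Ga)"
    using * leb[OF m] assms(1) by simp
  show "(LBINT s:{0<..}. time_change_density \<alpha> Ga s) = \<alpha>"
    using * leb[OF m] assms(1) set_lebesgue_integral_eq_integral(2)[OF *(1)] by simp
qed

text \<open>A compact interval of positive mass away from 0 keeps \<open>t powr \<alpha> * s\<close>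
  comparable to \<open>t powr \<alpha>\<close> in the bound for \<open>Z\<close>. It exists since
  countably many such intervals exhaust the half-line, whose mass is \<alpha> > 0.\<close>

lemma time_change_density_mass:
  assumes "0 < \<alpha>" "stable_density \<alpha> Ga"
  shows "\<exists>a>0. \<exists>b>0. (LBINT s:{a..b}. time_change_density \<alpha> Ga s) > 0"
proof (rule ccontr)
  let ?H = "time_change_density \<alpha> Ga"
  assume "\<not> ?thesis"
  then have le: "(LBINT s:{a..b}. ?H s) \<le> 0" if "a > 0" "b > 0" for a b using that by force
  have ae: "AE s in lborel. s \<in> {1 / real (Suc n)..real (Suc n)} \<longrightarrow> ?H s = 0" for n
  proof -
    let ?I = "{1 / real (Suc n)..real (Suc n)}"
    have sub: "?I \<subseteq> {0<..}" by (auto intro: less_le_trans[rotated])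
    have int: "integrable lborel (\<lambda>s. indicator ?I s *\<^sub>R ?H s)"
      using set_integrable_subset[OF time_change_density_integral(1)[OF assms] _ sub] by (simp add: set_integrable_def)
    have nn: "0 \<le> indicator ?I s *\<^sub>R ?H s" for s
      using time_change_density_nonneg[OF assms(2), of s] sub by (auto simp: indicator_def)
    have "(\<integral>s. indicator ?I s *\<^sub>R ?H s \<partial>lborel) = 0"
    proof (rule antisym)
      show "(\<integral>s. indicator ?I s *\<^sub>R ?H s \<partial>lborel) \<le> 0"
        using le[of "1 / real (Suc n)" "real (Suc n)"] by (simp add: set_lebesgue_integral_def)
      show "0 \<le> (\<integral>s. indicator ?I s *\<^sub>R ?H s \<partial>lborel)"
        by (rule Bochner_Integration.integral_nonneg) (rule nn)
    qed
    then have "AE s in lborel. indicator ?I s *\<^sub>R ?H s = 0"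
      using integral_nonneg_eq_0_iff_AE[OF int] nn by auto
    then show ?thesis by eventually_elim (auto simp: indicator_def split: if_splits)
  qed
  then have "AE s in lborel. \<forall>n. s \<in> {1 / real (Suc n)..real (Suc n)} \<longrightarrow> ?H s = 0"
    unfolding AE_all_countable by (intro allI)
  then have "AE s in lborel. indicator {0<..} s *\<^sub>R ?H s = 0"
  proof eventually_elim
    case (elim s)
    show ?case
    proof (cases "s > 0")
      case True
      obtain n where n: "real n \<ge> max s (1 / s)" using real_arch_simple by blast
      then have "s \<le> real (Suc n)" "1 / s \<le> real (Suc n)" by auto
      then have "s \<in> {1 / real (Suc n)..real (Suc n)}" using True by (simp add: field_simps)
      then have "?H s = 0" using elim by blast
      then show ?thesis by simp
    qed simp
  qed
  then have "(LBINT s:{0<..}. ?H s) = 0"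
    unfolding set_lebesgue_integral_def by (rule integral_eq_zero_AE)
  then show False using time_change_density_integral(2)[OF assms] assms(1) by simp
qed

section \<open>Lower bound for the kernel \<open>Z\<close>\<close>

context stable_symbol
begin

text \<open>Integrability of the time integral is only needed, and only shown, for almost every \<open>x\<close>: testing
  against a Gaussian replaces pointwise tail estimates for \<open>G\<close>.\<close>

lemma AE_Z_integrand_integrable:
  assumes "0 < \<alpha>" "stable_density \<alpha> Ga" "t > 0"
  shows "AE x in lborel. set_integrable lborel {0<..} (\<lambda>s. G \<beta> \<nu> (t powr \<alpha> * s) x * time_change_density \<alpha> Ga s)"
proof -
  let ?H = "time_change_density \<alpha> Ga" and ?e = "\<lambda>x::'a. exp (- (norm x)\<^sup>2 / 2)"
  note [measurable] = measurable_time_change_density[OF assms(2)]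
  obtain K where K: "K \<ge> 0" "\<And>\<tau>. \<tau> > 0 \<Longrightarrow> (\<integral>\<^sup>+x. ennreal (G \<beta> \<nu> \<tau> x * ?e x) \<partial>lborel) \<le> ennreal K"
    using G_gaussian_integral_bound by blast
  \<comment> \<open>The double integral of this weighted integrand is finite because the bound
    \<open>K\<close> does not depend on \<open>s\<close> and \<open>?H\<close> has finite
    mass.\<close>
  define h where "h x s = ennreal (indicator {0<..} s * ?H s) * ennreal (G \<beta> \<nu> (t powr \<alpha> * s) x * ?e x)" for x s
  have [measurable]: "case_prod h \<in> borel_measurable (lborel \<Otimes>\<^sub>M lborel)"
    unfolding h_def by measurable
  have "(\<integral>\<^sup>+x. (\<integral>\<^sup>+s. h x s \<partial>lborel) \<partial>lborel) = (\<integral>\<^sup>+s. (\<integral>\<^sup>+x. h x s \<partial>lborel) \<partial>lborel)"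
    by (rule lborel_pair.Fubini') simp
  also have "\<dots> \<le> (\<integral>\<^sup>+s. ennreal (indicator {0<..} s * ?H s) * ennreal K \<partial>lborel)"
  proof (rule nn_integral_mono)
    fix s
    have "(\<integral>\<^sup>+x. h x s \<partial>lborel) = ennreal (indicator {0<..} s * ?H s) * (\<integral>\<^sup>+x. ennreal (G \<beta> \<nu> (t powr \<alpha> * s) x * ?e x) \<partial>lborel)"
      unfolding h_def by (rule nn_integral_cmult) measurable
    also have "\<dots> \<le> ennreal (indicator {0<..} s * ?H s) * ennreal K"
      using K(2)[of "t powr \<alpha> * s"] assms(3) by (cases "s > 0") (auto intro: mult_left_mono)
    finally show "(\<integral>\<^sup>+x. h x s \<partial>lborel) \<le> ennreal (indicator {0<..} s * ?H s) * ennreal K" .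
  qed
  also have "\<dots> = (\<integral>\<^sup>+s. ennreal (indicator {0<..} s * ?H s) \<partial>lborel) * ennreal K"
    by (rule nn_integral_multc) measurable
  also have "\<dots> < \<infinity>"
  proof -
    have "(\<integral>\<^sup>+s. ennreal (indicator {0<..} s * ?H s) \<partial>lborel) < \<infinity>"
      using time_change_density_integral(1)[OF assms(1,2)]
      by (subst nn_integral_eq_integral) (auto simp: set_integrable_def indicator_def time_change_density_nonneg[OF assms(2)] intro!: AE_I2)
    then show ?thesis by (simp add: ennreal_mult_less_top)
  qed
  finally have "AE x in lborel. (\<integral>\<^sup>+s. h x s \<partial>lborel) \<noteq> \<infinity>"
    by (intro nn_integral_PInf_AE) auto
  then show ?thesis
  proof eventually_elim
    case (elim x)
    have "(\<integral>\<^sup>+s. h x s \<partial>lborel) = (\<integral>\<^sup>+s. ennreal (?e x) * ennreal (norm (indicator {0<..} s *\<^sub>R (G \<beta> \<nu> (t powr \<alpha> * s) x * ?H s))) \<partial>lborel)"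
      using assms(3)
      by (intro nn_integral_cong)
        (auto simp: h_def indicator_def abs_mult G_nonneg time_change_density_nonneg[OF assms(2)] mult_ac simp flip: ennreal_mult')
    also have "\<dots> = ennreal (?e x) * (\<integral>\<^sup>+s. ennreal (norm (indicator {0<..} s *\<^sub>R (G \<beta> \<nu> (t powr \<alpha> * s) x * ?H s))) \<partial>lborel)"
      by (rule nn_integral_cmult) measurable
    finally have "(\<integral>\<^sup>+s. ennreal (norm (indicator {0<..} s *\<^sub>R (G \<beta> \<nu> (t powr \<alpha> * s) x * ?H s))) \<partial>lborel) < \<infinity>"
      using elim by (auto simp: ennreal_mult_eq_top_iff less_top)
    then show ?case
      unfolding set_integrable_def by (intro integrableI_bounded) measurable
  qed
qed

text \<open>The time integral is cut down to \<open>{a..b}\<close>; there the admissible radius is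
  smallest at \<open>s = a\<close> and the lower bound for \<open>G\<close> at \<open>s = b\<close>.
  A non-integrable integrand would make the Bochner integral, and with it \<open>Z\<close>, equal to
  0 by default; therefore the bound is claimed only for almost every \<open>x\<close>.\<close>

lemma Z_lower_bound:
  assumes "0 < \<alpha>" "stable_density \<alpha> Ga"
  shows "\<exists>c>0. \<exists>\<delta>>0. \<forall>t>0. AE x in lborel. norm x \<le> \<delta> * t powr (\<alpha> / \<beta>) \<longrightarrow>
    c * t powr (- (\<alpha> * DIM('a) / \<beta>)) \<le> Z \<alpha> \<beta> \<nu> Ga t x"
proof -
  let ?H = "time_change_density \<alpha> Ga"
  obtain c \<delta> where c: "c > 0" and \<delta>: "\<delta> > 0" and low:
    "\<And>\<tau> x. \<tau> > 0 \<Longrightarrow> norm x \<le> \<delta> * \<tau> powr (1 / \<beta>) \<Longrightarrow> c * \<tau> powr (- real DIM('a) / \<beta>) \<le> G \<beta> \<nu> \<tau> x"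
    using G_lower_bound by blast
  obtain a b where ab: "a > 0" "b > 0" and mass: "(LBINT s:{a..b}. ?H s) > 0"
    using time_change_density_mass[OF assms] by blast
  define m where "m = (LBINT s:{a..b}. ?H s)"
  define C where "C = 1 / \<alpha> * (c * b powr (- real DIM('a) / \<beta>) * m)"
  define D where "D = \<delta> * a powr (1 / \<beta>)"
  have "C > 0" "D > 0" using c \<delta> ab mass assms by (simp_all add: C_def D_def m_def)
  moreover have "AE x in lborel. norm x \<le> D * t powr (\<alpha> / \<beta>) \<longrightarrow>
    C * t powr (- (\<alpha> * DIM('a) / \<beta>)) \<le> Z \<alpha> \<beta> \<nu> Ga t x" if t: "t > 0" for t
    using AE_Z_integrand_integrable[OF assms t]
  proof eventually_elim
    case (elim x)
    let ?F = "\<lambda>s. G \<beta> \<nu> (t powr \<alpha> * s) x * ?H s"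
    let ?q = "c * (t powr \<alpha> * b) powr (- real DIM('a) / \<beta>)"
    have sub: "{a..b} \<subseteq> {0<..}" using ab by auto
    have Hab: "set_integrable lborel {a..b} ?H"
      by (rule set_integrable_subset[OF time_change_density_integral(1)[OF assms] _ sub]) simp
    show ?case
    proof
      assume x: "norm x \<le> D * t powr (\<alpha> / \<beta>)"
      have "?q \<le> G \<beta> \<nu> (t powr \<alpha> * s) x" if s: "s \<in> {a..b}" for s
      proof -
        have "norm x \<le> \<delta> * (t powr \<alpha> * a) powr (1 / \<beta>)"
          using x t ab by (simp add: D_def powr_mult powr_powr mult_ac)
        also have "\<dots> \<le> \<delta> * (t powr \<alpha> * s) powr (1 / \<beta>)"
          using s t ab \<beta> \<delta> by (intro mult_left_mono powr_mono2) auto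
        finally have "c * (t powr \<alpha> * s) powr (- real DIM('a) / \<beta>) \<le> G \<beta> \<nu> (t powr \<alpha> * s) x"
          using s t ab by (intro low) auto
        moreover have "?q \<le> c * (t powr \<alpha> * s) powr (- real DIM('a) / \<beta>)"
          using s t ab \<beta> c by (intro mult_left_mono powr_mono2') auto
        ultimately show ?thesis by linarith
      qed
      then have "(LBINT s:{a..b}. ?q * ?H s) \<le> (LBINT s:{a..b}. ?F s)"
        using time_change_density_nonneg[OF assms(2)] sub
        by (intro set_integral_mono set_integrable_subset[OF elim] sub) (use Hab in \<open>auto intro!: mult_right_mono\<close>)
      also have "\<dots> \<le> (LBINT s:{0<..}. ?F s)"
        unfolding set_lebesgue_integral_def
      proof (rule integral_mono)
        show "integrable lborel (\<lambda>s. indicator {a..b} s *\<^sub>R ?F s)"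
          using set_integrable_subset[OF elim _ sub] by (simp add: set_integrable_def)
        show "integrable lborel (\<lambda>s. indicator {0<..} s *\<^sub>R ?F s)"
          using elim by (simp add: set_integrable_def)
        show "indicator {a..b} s *\<^sub>R ?F s \<le> indicator {0<..} s *\<^sub>R ?F s" for s
          using sub t G_nonneg[of "t powr \<alpha> * s" x] time_change_density_nonneg[OF assms(2), of s]
          by (auto simp: indicator_def)
      qed
      finally have "?q * m \<le> (LBINT s:{0<..}. ?F s)" by (simp add: m_def)
      then have "1 / \<alpha> * (?q * m) \<le> 1 / \<alpha> * (LBINT s:{0<..}. ?F s)"
        using assms(1) by (intro mult_left_mono) auto
      also have "\<dots> = Z \<alpha> \<beta> \<nu> Ga t x"
        by (simp add: Z_def time_change_density_def mult.assoc)
      also have "?q = c * b powr (- real DIM('a) / \<beta>) * t powr (- (\<alpha> * DIM('a) / \<beta>))"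
        using t ab by (simp add: powr_mult powr_powr)
      also have "1 / \<alpha> * (c * b powr (- real DIM('a) / \<beta>) * t powr (- (\<alpha> * DIM('a) / \<beta>)) * m) =
          C * t powr (- (\<alpha> * DIM('a) / \<beta>))"
        by (simp add: C_def)
      finally show "C * t powr (- (\<alpha> * DIM('a) / \<beta>)) \<le> Z \<alpha> \<beta> \<nu> Ga t x" .
    qed
  qed
  ultimately show ?thesis by blast
qed

end

section \<open>Translations, null sets on products, and the positive part of
  \<open>Y\<close>\<close>

lemma lborel_nn_integral_shift:
  fixes F :: "'a::euclidean_space \<Rightarrow> ennreal"
  assumes [measurable]: "F \<in> borel_measurable borel"
  shows "(\<integral>\<^sup>+x. F (x - y) \<partial>lborel) = (\<integral>\<^sup>+x. F x \<partial>lborel)"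
proof -
  have "(\<integral>\<^sup>+x. F x \<partial>lborel) = (\<integral>\<^sup>+x. F x \<partial>distr lborel borel ((+) (- y)))"
    by (simp only: lborel_distr_plus)
  then show ?thesis by (simp add: nn_integral_distr)
qed

lemma AE_lebesgue_on_iff_lborel:
  fixes S :: "'a::euclidean_space set"
  assumes "S \<in> sets borel"
  shows "(AE x in lebesgue_on S. P x) \<longleftrightarrow> (AE x in lborel. x \<in> S \<longrightarrow> P x)"
  using assms by (simp add: AE_restrict_space_iff AE_completion_iff)

text \<open>Turns the conditions on a solution into iterated ones, time first, so that they can be
  used at almost every fixed time.\<close>

lemma AE_lebesgue_on_Times:
  fixes P :: "real \<Rightarrow> 'a::euclidean_space \<Rightarrow> bool"
  assumes "A \<in> sets borel" "AE (t, x) in lebesgue_on (A \<times> UNIV). P t x"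
  shows "AE t in lborel. AE x in lborel. t \<in> A \<longrightarrow> P t x"
proof -
  have "A \<times> (UNIV :: 'a set) \<in> sets borel"
    using assms(1) unfolding borel_prod[symmetric] by simp
  with assms(2) have "AE z in lborel. z \<in> A \<times> (UNIV :: 'a set) \<longrightarrow> (case z of (t, x) \<Rightarrow> P t x)"
    by (simp add: AE_lebesgue_on_iff_lborel)
  then have "AE z in lborel \<Otimes>\<^sub>M lborel. z \<in> A \<times> (UNIV :: 'a set) \<longrightarrow> (case z of (t, x) \<Rightarrow> P t x)"
    by (simp only: lborel_prod)
  from lborel_pair.AE_pair[OF this] show ?thesis by simp
qed

lemma measurable_uncurry:
  assumes "case_prod Y \<in> borel_measurable (borel \<Otimes>\<^sub>M borel)"
    and "h \<in> borel_measurable M" "y \<in> borel_measurable M"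
  shows "(\<lambda>p. Y (h p) (y p)) \<in> borel_measurable M"
  using measurable_compose[OF measurable_Pair[OF assms(2,3)] assms(1)] by simp

text \<open>If the integral vanished, Fubini would give \<open>Y \<tau> x \<le> 0\<close> for almost
  every \<tau> at almost every \<open>x\<close>, and the Volterra equation with its non-negative
  kernel would give \<open>z t x \<le> 0\<close>. \<open>ennreal\<close> cuts \<open>Y\<close> to
  its positive part; the truncation by 1 keeps the zero set and yields a bounded function of
  \<tau>.\<close>

lemma positive_part_mass_of_Y:
  fixes Y :: "real \<Rightarrow> 'a::euclidean_space \<Rightarrow> real"
  assumes "\<alpha> < 1" "solves_Y_equation \<alpha> z Y" "0 < t" "t \<le> T" "\<rho> > 0"
    and z: "AE x in lborel. norm x \<le> \<rho> \<longrightarrow> 0 < z t x"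
  shows "(\<integral>\<^sup>+\<tau>. indicator {0<..<T} \<tau> * min 1 (\<integral>\<^sup>+x. ennreal (Y \<tau> x) \<partial>lborel) \<partial>lborel) > 0"
proof (rule ccontr)
  have [measurable]: "case_prod Y \<in> borel_measurable (borel \<Otimes>\<^sub>M borel)"
    using assms(2) by (simp add: solves_Y_equation_def borel_prod)
  note [measurable (raw)] = measurable_uncurry[OF this]
  assume "\<not> ?thesis"
  then have "(\<integral>\<^sup>+\<tau>. indicator {0<..<T} \<tau> * min 1 (\<integral>\<^sup>+x. ennreal (Y \<tau> x) \<partial>lborel) \<partial>lborel) = 0"
    by simp
  then have "AE \<tau> in lborel. indicator {0<..<T} \<tau> * min 1 (\<integral>\<^sup>+x. ennreal (Y \<tau> x) \<partial>lborel) = 0"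
    by (subst (asm) nn_integral_0_iff_AE) auto
  then have "AE \<tau> in lborel. AE x in lborel. \<tau> \<in> {0<..<T} \<longrightarrow> Y \<tau> x \<le> 0"
  proof eventually_elim
    case (elim \<tau>)
    show ?case
    proof (cases "\<tau> \<in> {0<..<T}")
      case True
      then have "(\<integral>\<^sup>+x. ennreal (Y \<tau> x) \<partial>lborel) = 0" using elim by (auto simp: min_def split: if_splits)
      then have "AE x in lborel. ennreal (Y \<tau> x) = 0"
        by (subst (asm) nn_integral_0_iff_AE) auto
      then show ?thesis by eventually_elim (simp add: ennreal_eq_0_iff)
    qed auto
  qed
  then have "AE x in lborel. AE \<tau> in lborel. \<tau> \<in> {0<..<T} \<longrightarrow> Y \<tau> x \<le> 0"
  proof (subst (asm) lborel_pair.AE_commute)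
    have "Measurable.pred (lborel \<Otimes>\<^sub>M lborel) (\<lambda>p. fst p \<in> {0<..<T} \<longrightarrow> Y (fst p) (snd p) \<le> 0)"
      by measurable
    then show "{p \<in> space (lborel \<Otimes>\<^sub>M lborel). fst p \<in> {0<..<T} \<longrightarrow> Y (fst p) (snd p) \<le> 0}
        \<in> sets (lborel \<Otimes>\<^sub>M lborel)"
      by (simp add: pred_def)
  qed
  \<comment> \<open>The Volterra equation is imposed only away from the origin, which is a null
    set.\<close>
  with z AE_lborel_singleton[of "0::'a"] have "AE x in lborel. x \<notin> ball (0::'a) \<rho>"
  proof eventually_elim
    case (elim x)
    have "z t x = (LBINT s:{0<..<t}. g (1 - \<alpha>) (t - s) * Y s x)"
      using assms(2,3) elim(2) by (simp add: solves_Y_equation_def)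
    also have "\<dots> \<le> 0"
      unfolding set_lebesgue_integral_def
    proof -
      have "0 \<le> (\<integral>s. - (indicator {0<..<t} s *\<^sub>R (g (1 - \<alpha>) (t - s) * Y s x)) \<partial>lborel)"
      proof (rule integral_nonneg_AE)
        show "AE s in lborel. 0 \<le> - (indicator {0<..<t} s *\<^sub>R (g (1 - \<alpha>) (t - s) * Y s x))"
          using elim(3)
        proof eventually_elim
          case (elim s)
          have "0 \<le> g (1 - \<alpha>) (t - s)" using assms(1) by (simp add: g_def Gamma_real_pos less_imp_le)
          then show ?case using elim assms(4) by (auto simp: indicator_def mult_nonneg_nonpos)
        qed
      qed
      then show "(\<integral>s. indicator {0<..<t} s *\<^sub>R (g (1 - \<alpha>) (t - s) * Y s x) \<partial>lborel) \<le> 0"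
        by simp
    qed
    finally show ?case using elim(1) by auto
  qed
  then have "emeasure lborel (ball (0::'a) \<rho>) = 0"
    by (subst (asm) AE_iff_measurable[where N = "ball 0 \<rho>"]) auto
  then show False using assms(5) unit_ball_vol_pos[of "DIM('a)"] by (simp add: emeasure_ball)
qed

section \<open>Lower bounds for integral solutions\<close>

text \<open>At the origin the power is 0 by the convention for \<open>powr\<close>, so lower bounds
  for the datum are used only at almost every point.\<close>

definition radial_datum :: "real \<Rightarrow> 'a::euclidean_space \<Rightarrow> real" where
  "radial_datum \<epsilon> x = (if norm x < 1 then norm x powr (\<epsilon> - DIM('a)) else 0)"

lemma measurable_radial_datum [measurable]: "radial_datum \<epsilon> \<in> borel_measurable borel"
  unfolding radial_datum_def by measurable

lemma radial_datum_nonneg: "0 \<le> radial_datum \<epsilon> x"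
  by (simp add: radial_datum_def)

lemma integrable_radial_datum:
  fixes \<epsilon> :: real
  assumes "0 < \<epsilon>" "\<epsilon> < DIM('a)"
  shows "integrable lebesgue (radial_datum \<epsilon> :: 'a::euclidean_space \<Rightarrow> real)"
proof -
  let ?d = "real DIM('a)"
  \<comment> \<open>The shells are \<open>?r n < norm x \<le> 2 * ?r n\<close>; the factor 4 below
    puts them inside open balls. Value times volume is of order \<open>?r n powr \<epsilon>\<close>,
    a geometric series.\<close>
  let ?r = "\<lambda>n. 1 / 2 ^ Suc n :: real"
  have "(\<integral>\<^sup>+x. ennreal (radial_datum \<epsilon> (x::'a)) \<partial>lborel) < \<infinity>"
  proof (rule nn_integral_dyadic_bound[where \<rho> = "\<lambda>n. 4 * ?r n" and a = "\<lambda>n. ?r n powr (\<epsilon> - ?d)"])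
    fix x :: 'a assume x: "x \<noteq> 0" and "ennreal (radial_datum \<epsilon> x) \<noteq> 0"
    then have x1: "norm x < 1" by (auto simp: radial_datum_def split: if_splits)
    then obtain n where n: "2 ^ n \<le> 1 / norm x" "1 / norm x < 2 ^ Suc n"
      using ex_dyadic[of "1 / norm x"] x by auto
    have "norm x < 4 * ?r n" using n(1) x by (simp add: field_simps)
    moreover have "?r n \<le> norm x" using n(2) x by (simp add: field_simps)
    then have "norm x powr (\<epsilon> - ?d) \<le> ?r n powr (\<epsilon> - ?d)"
      using assms by (intro powr_mono2') auto
    ultimately show "\<exists>n. norm x < 4 * ?r n \<and> ennreal (radial_datum \<epsilon> x) \<le> ennreal (?r n powr (\<epsilon> - ?d))"
      using x1 by (intro exI[of _ n]) (auto simp: radial_datum_def intro!: ennreal_leI)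
  next
    have "?r n powr (\<epsilon> - ?d) * (4 * ?r n) ^ DIM('a) = 4 ^ DIM('a) * ((1/2) powr \<epsilon>) * ((1/2) powr \<epsilon>) ^ n" for n
    proof -
      have "?r n = (1/2) powr (real (Suc n))" by (simp only: powr_realpow) (simp add: power_one_over)
      moreover have "(4 * ?r n) ^ DIM('a) = 4 ^ DIM('a) * ?r n powr ?d"
        by (subst power_mult_distrib, subst powr_realpow) auto
      moreover have "?r n powr (\<epsilon> - ?d) * ?r n powr ?d = ?r n powr \<epsilon>" by (simp flip: powr_add)
      moreover have "((1/2::real) powr (real (Suc n))) powr \<epsilon> = ((1/2) powr \<epsilon>) * ((1/2) powr \<epsilon>) ^ n"
        by (simp add: powr_powr powr_realpow[symmetric] powr_add[symmetric] algebra_simps)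
      ultimately show ?thesis by (simp add: mult_ac)
    qed
    moreover have "(1/2::real) powr \<epsilon> < 1" using assms(1) by (simp add: powr_less_one powr01_less_one)
    ultimately show "summable (\<lambda>n. ?r n powr (\<epsilon> - ?d) * (4 * ?r n) ^ DIM('a))"
      by (auto intro!: summable_mult summable_geometric)
  qed auto
  then have "integrable lborel (radial_datum \<epsilon> :: 'a \<Rightarrow> real)"
    by (intro integrableI_bounded) (auto simp: radial_datum_nonneg)
  then show ?thesis by (simp add: integrable_completion)
qed

text \<open>Only \<open>y\<close> in the ball of radius \<open>R\<close> is kept: there
  \<open>norm (x - y) \<le> 2 * R\<close>, and the datum is at least
  \<open>R powr (\<epsilon> - DIM('a))\<close>, since it decreases radially and
  \<open>R \<le> 1\<close> keeps the ball in its support. The volume of the ball turns this into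
  \<open>R powr \<epsilon>\<close>.\<close>

lemma convolution_radial_datum_ge:
  fixes x :: "'a::euclidean_space" and k :: "'a \<Rightarrow> real" and \<epsilon> R q :: real
  assumes "\<epsilon> < DIM('a)" "0 < R" "R \<le> 1" "0 \<le> q" "norm x \<le> R"
    and k: "AE y in lborel. norm y \<le> 2 * R \<longrightarrow> q \<le> k y"
  shows "ennreal (unit_ball_vol (DIM('a)) * q * R powr \<epsilon>) \<le>
    (\<integral>\<^sup>+y. ennreal (k (x - y)) * ennreal (radial_datum \<epsilon> y) \<partial>lebesgue)"
proof -
  let ?d = "real DIM('a)"
  have "R powr (\<epsilon> - ?d) * R ^ DIM('a) = R powr \<epsilon>"
    using assms(2) by (simp add: powr_realpow[symmetric] flip: powr_add)
  then have "ennreal (unit_ball_vol ?d * q * R powr \<epsilon>) = ennreal (q * R powr (\<epsilon> - ?d)) * emeasure lborel (ball (0::'a) R)"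
    using assms by (simp add: emeasure_ball mult_ac flip: ennreal_mult')
  also have "\<dots> = (\<integral>\<^sup>+y. ennreal (q * R powr (\<epsilon> - ?d)) * indicator (ball (0::'a) R) y \<partial>lborel)"
    by (simp add: nn_integral_cmult_indicator)
  also have "\<dots> \<le> (\<integral>\<^sup>+y. ennreal (k (x - y)) * ennreal (radial_datum \<epsilon> y) \<partial>lborel)"
  proof (rule nn_integral_mono_AE)
    show "AE y in lborel. ennreal (q * R powr (\<epsilon> - ?d)) * indicator (ball (0::'a) R) y
        \<le> ennreal (k (x - y)) * ennreal (radial_datum \<epsilon> y)"
      using AE_lborel_reflect[OF k, of x] AE_lborel_singleton[of "0::'a"]
    proof eventually_elim
      case (elim y)
      show ?case
      proof (cases "y \<in> ball 0 R")
        case True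
        then have y: "norm y < R" by simp
        have "norm (x - y) \<le> 2 * R" using norm_triangle_ineq4[of x y] y assms(5) by linarith
        then have "q \<le> k (x - y)" using elim by simp
        moreover have "R powr (\<epsilon> - ?d) \<le> radial_datum \<epsilon> y"
          using elim y assms by (auto simp: radial_datum_def intro!: powr_mono2')
        ultimately have "ennreal q * ennreal (R powr (\<epsilon> - ?d)) \<le> ennreal (k (x - y)) * ennreal (radial_datum \<epsilon> y)"
          by (intro mult_mono ennreal_leI) auto
        then show ?thesis using True assms(4) by (simp add: ennreal_mult)
      qed simp
    qed
  qed
  finally show ?thesis by (simp only: nn_integral_completion)
qed

text \<open>Only the Duhamel term is kept, with \<open>f \<phi>\<close> as lower bound for the
  source on the cylinder. After Tonelli, translation invariance makes the mass of the positive part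
  of \<open>Y (t - r)\<close> independent of the source point, so the ball contributes its volume as
  a factor.\<close>

lemma mass_ge_of_cylinder:
  fixes u :: "real \<Rightarrow> 'a::euclidean_space \<Rightarrow> ennreal" and Y :: "real \<Rightarrow> 'a \<Rightarrow> real"
  assumes sol: "integral_solution z Y f u0 T u"
    and [measurable]: "case_prod Y \<in> borel_measurable (borel \<Otimes>\<^sub>M borel)"
    and f: "mono_on {0..} f" "0 \<le> f \<phi>" and \<phi>: "0 \<le> \<phi>" and "0 \<le> a" "0 \<le> \<rho>"
    and low: "AE t in lborel. AE x in lborel. t \<in> {0<..<T} \<longrightarrow> t \<in> {a<..<b} \<longrightarrow> x \<in> ball 0 \<rho> \<longrightarrow> ennreal \<phi> \<le> u t x"
  shows "AE t in lborel. t \<in> {0<..<T} \<longrightarrow>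
    ennreal (f \<phi> * unit_ball_vol DIM('a) * \<rho> ^ DIM('a)) *
      (\<integral>\<^sup>+r. indicator {a<..<b} r * (indicator {0<..} (t - r) * (\<integral>\<^sup>+x. ennreal (Y (t - r) x) \<partial>lborel)) \<partial>lborel)
    \<le> (\<integral>\<^sup>+x. u t x \<partial>lebesgue)"
proof -
  note [measurable (raw)] = measurable_uncurry[OF assms(2)]
  let ?B = "ball (0::'a) \<rho>"
  have [measurable]: "?B \<in> sets borel" by simp
  \<comment> \<open>At an infinite value \<open>enn2real\<close> returns 0 and the monotonicity
    argument for \<open>f\<close> would break down.\<close>
  have fin: "AE t in lborel. AE x in lborel. t \<in> {0<..<T} \<longrightarrow> u t x < \<infinity>"
  proof -
    have "AE t in lborel. AE x in lborel. t \<in> {0..<T} \<longrightarrow> u t x < \<infinity>"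
      using sol by (intro AE_lebesgue_on_Times) (auto simp: integral_solution_def)
    then show ?thesis
    proof eventually_elim
      case (elim t)
      then show ?case by eventually_elim auto
    qed
  qed
  have eq: "AE t in lborel. AE x in lborel. t \<in> {0<..<T} \<longrightarrow> 
        u t x = (\<integral>\<^sup>+y. ennreal (z t (x - y)) * ennreal (u0 y) \<partial>lebesgue)
          + (\<integral>\<^sup>+s\<in>{0<..<t}.
               (\<integral>\<^sup>+y. ennreal (Y (t - s) (x - y)) * ennreal (f (enn2real (u s y))) \<partial>lebesgue)
             \<partial>lebesgue)"
    using sol by (intro AE_lebesgue_on_Times) (auto simp: integral_solution_def)
  have src: "AE s in lborel. AE y in lborel. s \<in> {0<..<T} \<longrightarrow> s \<in> {a<..<b} \<longrightarrow> y \<in> ?B \<longrightarrow> f \<phi> \<le> f (enn2real (u s y))"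
    using fin low
  proof eventually_elim
    case (elim s)
    then show ?case
    proof eventually_elim
      case (elim y)
      show ?case
      proof (intro impI)
        assume "s \<in> {0<..<T}" "s \<in> {a<..<b}" "y \<in> ?B"
        then have "ennreal \<phi> \<le> u s y" "u s y < \<infinity>" using elim by auto
        then have "\<phi> \<le> enn2real (u s y)" using \<phi> enn2real_mono[of "ennreal \<phi>" "u s y"] by simp
        then show "f \<phi> \<le> f (enn2real (u s y))" using \<phi> f(1) by (auto intro: mono_onD)
      qed
    qed
  qed
  \<comment> \<open>A minorant of the Duhamel integrand, with all restrictions written as indicators
    so that the three integrals can be exchanged.\<close>
  define k where "k t x r y = (indicator {a<..<b} r * indicator {0<..} (t - r) :: ennreal) *
    (ennreal (Y (t - r) (x - y)) * (ennreal (f \<phi>) * indicator ?B y))" for t r and x y :: 'a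
  from eq show ?thesis
  proof eventually_elim
    case (elim t)
    show ?case
    proof
      assume t: "t \<in> {0<..<T}"
      have [measurable]: "(\<lambda>x. Y r x) \<in> borel_measurable borel" for r by measurable
      have "(\<integral>\<^sup>+x. u t x \<partial>lebesgue) \<ge> (\<integral>\<^sup>+x. (\<integral>\<^sup>+r. (\<integral>\<^sup>+y. k t x r y \<partial>lborel) \<partial>lborel) \<partial>lebesgue)"
      proof (rule nn_integral_mono_AE, subst AE_completion_iff)
        show "AE x in lborel. (\<integral>\<^sup>+r. (\<integral>\<^sup>+y. k t x r y \<partial>lborel) \<partial>lborel) \<le> u t x"
          using elim
        proof eventually_elim
          case (elim x)
          have "(\<integral>\<^sup>+r. (\<integral>\<^sup>+y. k t x r y \<partial>lborel) \<partial>lborel) \<le>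
            (\<integral>\<^sup>+s\<in>{0<..<t}. (\<integral>\<^sup>+y. ennreal (Y (t - s) (x - y)) * ennreal (f (enn2real (u s y))) \<partial>lebesgue) \<partial>lborel)"
          proof (rule nn_integral_mono_AE)
            show "AE r in lborel. (\<integral>\<^sup>+y. k t x r y \<partial>lborel) \<le>
              (\<integral>\<^sup>+y. ennreal (Y (t - r) (x - y)) * ennreal (f (enn2real (u r y))) \<partial>lebesgue) * indicator {0<..<t} r"
              using src
            proof eventually_elim
              case (elim r)
              show ?case
              proof (cases "r \<in> {a<..<b} \<and> r < t")
                case True
                \<comment> \<open>The assumption \<open>0 \<le> a\<close> and
                  \<open>r < t < T\<close> put \<open>r\<close> into the range where
                  \<open>src\<close> applies.\<close>
                then have r: "r \<in> {0<..<T}" "r \<in> {0<..<t}" "r \<in> {a<..<b}" using t assms(6) by auto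
                have "(\<integral>\<^sup>+y. k t x r y \<partial>lborel) \<le> (\<integral>\<^sup>+y. ennreal (Y (t - r) (x - y)) * ennreal (f (enn2real (u r y))) \<partial>lborel)"
                proof (rule nn_integral_mono_AE)
                  show "AE y in lborel. k t x r y \<le> ennreal (Y (t - r) (x - y)) * ennreal (f (enn2real (u r y)))"
                    using elim
                  proof eventually_elim
                    case (elim y)
                    have "ennreal (f \<phi>) * indicator ?B y \<le> ennreal (f (enn2real (u r y)))"
                      using elim r by (cases "y \<in> ?B") (auto intro: ennreal_leI)
                    then show ?case using r by (simp add: k_def mult_left_mono)
                  qed
                qed
                then show ?thesis using r by (simp add: nn_integral_completion)
              next
                case False
                then have "k t x r y = 0" for y by (auto simp: k_def)
                then show ?thesis by simp
              qed
            qed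
          qed
          also have "\<dots> \<le> u t x"
            using elim t by (simp add: nn_integral_completion)
          finally show ?case .
        qed
      qed
      also have "(\<integral>\<^sup>+x. (\<integral>\<^sup>+r. (\<integral>\<^sup>+y. k t x r y \<partial>lborel) \<partial>lborel) \<partial>lebesgue) =
          (\<integral>\<^sup>+x. (\<integral>\<^sup>+r. (\<integral>\<^sup>+y. k t x r y \<partial>lborel) \<partial>lborel) \<partial>lborel)"
        by (rule nn_integral_completion)
      also have "\<dots> = (\<integral>\<^sup>+r. (\<integral>\<^sup>+x. (\<integral>\<^sup>+y. k t x r y \<partial>lborel) \<partial>lborel) \<partial>lborel)"
        unfolding k_def by (rule lborel_pair.Fubini'[symmetric]) measurable
      also have "\<dots> = (\<integral>\<^sup>+r. (\<integral>\<^sup>+y. (\<integral>\<^sup>+x. k t x r y \<partial>lborel) \<partial>lborel) \<partial>lborel)"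
        unfolding k_def by (intro nn_integral_cong lborel_pair.Fubini'[symmetric]) measurable
      also have "\<dots> = (\<integral>\<^sup>+r. ennreal (f \<phi> * unit_ball_vol DIM('a) * \<rho> ^ DIM('a)) *
        (indicator {a<..<b} r * (indicator {0<..} (t - r) * (\<integral>\<^sup>+x. ennreal (Y (t - r) x) \<partial>lborel))) \<partial>lborel)"
      proof (rule nn_integral_cong)
        fix r :: real
        let ?M = "\<integral>\<^sup>+x. ennreal (Y (t - r) x) \<partial>lborel"
        let ?I = "indicator {a<..<b} r * indicator {0<..} (t - r) :: ennreal"
        have "(\<integral>\<^sup>+x. k t x r y \<partial>lborel) = (?I * ?M * ennreal (f \<phi>)) * indicator ?B y" for y
        proof -
          have "(\<integral>\<^sup>+x. k t x r y \<partial>lborel) = (\<integral>\<^sup>+x. (?I * (ennreal (f \<phi>) * indicator ?B y)) * ennreal (Y (t - r) (x - y)) \<partial>lborel)"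
            by (simp add: k_def mult_ac)
          also have "\<dots> = (?I * (ennreal (f \<phi>) * indicator ?B y)) * (\<integral>\<^sup>+x. ennreal (Y (t - r) (x - y)) \<partial>lborel)"
            by (rule nn_integral_cmult) measurable
          also have "(\<integral>\<^sup>+x. ennreal (Y (t - r) (x - y)) \<partial>lborel) = ?M"
            by (rule lborel_nn_integral_shift) measurable
          finally show ?thesis by (simp add: mult_ac)
        qed
        then have "(\<integral>\<^sup>+y. (\<integral>\<^sup>+x. k t x r y \<partial>lborel) \<partial>lborel) = (?I * ?M * ennreal (f \<phi>)) * emeasure lborel ?B"
          by (simp add: nn_integral_cmult_indicator)
        also have "\<dots> = ennreal (f \<phi> * unit_ball_vol DIM('a) * \<rho> ^ DIM('a)) * (indicator {a<..<b} r * (indicator {0<..} (t - r) * ?M))"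
          using assms by (simp add: emeasure_ball ennreal_mult mult_ac)
        finally show "(\<integral>\<^sup>+y. (\<integral>\<^sup>+x. k t x r y \<partial>lborel) \<partial>lborel) =
          ennreal (f \<phi> * unit_ball_vol DIM('a) * \<rho> ^ DIM('a)) * (indicator {a<..<b} r * (indicator {0<..} (t - r) * ?M))" .
      qed
      also have "\<dots> = ennreal (f \<phi> * unit_ball_vol DIM('a) * \<rho> ^ DIM('a)) *
          (\<integral>\<^sup>+r. indicator {a<..<b} r * (indicator {0<..} (t - r) * (\<integral>\<^sup>+x. ennreal (Y (t - r) x) \<partial>lborel)) \<partial>lborel)"
        by (rule nn_integral_cmult) measurable
      finally show "ennreal (f \<phi> * unit_ball_vol DIM('a) * \<rho> ^ DIM('a)) *
          (\<integral>\<^sup>+r. indicator {a<..<b} r * (indicator {0<..} (t - r) * (\<integral>\<^sup>+x. ennreal (Y (t - r) x) \<partial>lborel)) \<partial>lborel)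
         \<le> (\<integral>\<^sup>+x. u t x \<partial>lebesgue)" .
    qed
  qed
qed

text \<open>The model function at \<open>osgood_seq k p i\<close> is the gap to the next term. As
  the sequence more than doubles, the gap exceeds half of that term, which is
  \<open>osgood_seq k p i powr k\<close>; hence the constant \<open>c / 2\<close>.\<close>

lemma osgood_type_large_values:
  assumes "osgood_type k f"
  shows "\<exists>c>0. \<exists>\<phi>. (\<forall>i::nat. 0 < \<phi> i \<and> c * \<phi> i powr k \<le> f (\<phi> i)) \<and> filterlim \<phi> at_top sequentially"
proof -
  obtain p c where k: "k > 1" and p: "p > 2 powr (1 / (k - 1))" and c: "c > 0"
    and low: "\<And>s. s \<ge> 0 \<Longrightarrow> c * osgood_fun k p s \<le> f s"
    using assms unfolding osgood_type_def by blast
  let ?\<phi> = "osgood_seq k p"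
  note pos = osgood_seq_pos[OF k p]
  have "c / 2 * ?\<phi> i powr k \<le> f (?\<phi> i)" for i
  proof -
    have "c / 2 * ?\<phi> i powr k \<le> c * (?\<phi> (Suc i) - ?\<phi> i)"
      using osgood_seq_gt(2)[OF k p, of i] c by (simp add: field_simps)
    also have "\<dots> \<le> f (?\<phi> i)"
      using low[of "?\<phi> i"] pos[of i] by (simp add: osgood_fun_seq[OF k p])
    finally show ?thesis .
  qed
  moreover have "filterlim ?\<phi> at_top sequentially"
  proof (rule filterlim_at_top_mono)
    show "filterlim (\<lambda>i. p * real i) at_top sequentially"
      using pos[of 0] by (intro filterlim_tendsto_pos_mult_at_top[OF tendsto_const] filterlim_real_sequentially) simp
    have "p * (real i + 1) \<le> ?\<phi> i" for i
    proof (induction i)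
      case (Suc i)
      have "p \<le> ?\<phi> i"
        using strict_mono_less_eq[OF osgood_seq_strict_mono[OF k p], of 0 i] by simp
      then show ?case using Suc osgood_seq_gt(2)[OF k p, of i] by (simp add: algebra_simps del: osgood_seq.simps(2))
    qed simp
    moreover have "p * real i \<le> p * (real i + 1)" for i
      using pos[of 0] by (intro mult_left_mono) auto
    ultimately show "\<forall>\<^sub>F i in sequentially. p * real i \<le> ?\<phi> i"
      using order_trans by (intro always_eventually allI) blast
  qed
  ultimately show ?thesis using c pos by (intro exI[of _ "c / 2"] conjI exI[of _ ?\<phi>]) auto
qed

section \<open>Limits of powers and of window averages\<close>

lemma filterlim_powr_at_top:
  fixes e :: real
  assumes "e > 0"
  shows "filterlim (\<lambda>x. x powr e) at_top at_top"
proof -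
  have "filterlim (\<lambda>x. exp (e * ln x)) at_top at_top"
    by (intro filterlim_compose[OF exp_at_top] filterlim_tendsto_pos_mult_at_top[OF tendsto_const assms] ln_at_top)
  moreover have "\<forall>\<^sub>F x::real in at_top. exp (e * ln x) = x powr e"
    using eventually_gt_at_top[of 0] by eventually_elim (simp add: powr_def)
  ultimately show ?thesis by (rule filterlim_mono_eventually[OF _ order_refl order_refl])
qed

lemma tendsto_0_of_mult_le:
  fixes w :: "nat \<Rightarrow> ennreal"
  assumes N: "N < \<infinity>" and A: "filterlim A at_top sequentially"
    and le: "\<And>i. ennreal (A i) * w i \<le> N" and w: "\<And>i. w i < \<infinity>"
  shows "w \<longlonglongrightarrow> 0"
proof (rule tendsto_sandwich[of "\<lambda>_. 0" _ _ "\<lambda>i. ennreal (enn2real N / A i)"])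
  have "((\<lambda>i. enn2real N / A i) \<longlongrightarrow> 0) sequentially"
    by (rule real_tendsto_divide_at_top[OF tendsto_const A])
  then show "(\<lambda>i. ennreal (enn2real N / A i)) \<longlonglongrightarrow> 0"
    by (simp flip: ennreal_0)
  have "\<forall>\<^sub>F i in sequentially. A i > 0" using A by (auto simp: filterlim_at_top_dense)
  then show "\<forall>\<^sub>F i in sequentially. w i \<le> ennreal (enn2real N / A i)"
  proof eventually_elim
    case (elim i)
    obtain v where v: "w i = ennreal v" "v \<ge> 0" using w[of i] by (cases "w i") auto
    have "ennreal (A i * v) \<le> ennreal (enn2real N)"
      using le[of i] N elim v by (simp add: ennreal_mult)
    then have "A i * v \<le> enn2real N" by (simp add: ennreal_le_iff)
    then show ?case using elim v by (intro ord_eq_le_trans[OF v(1)] ennreal_leI) (simp add: field_simps)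
  qed
qed auto

text \<open>
  The averages of \<open>m\<close> over the windows tend to \<open>0\<close> almost everywhere, while each has
  \<open>t\<close>-integral \<open>(\<integral>m)/2\<close>; dominated convergence avoids Lebesgue's density theorem.
\<close>

lemma no_mass_windows:
  fixes m :: "real \<Rightarrow> ennreal" and N :: "real \<Rightarrow> ennreal" and A s :: "nat \<Rightarrow> real"
  assumes [measurable]: "m \<in> borel_measurable borel" and m1: "\<And>\<tau>. m \<tau> \<le> 1"
    and msupp: "\<And>\<tau>. \<tau> \<notin> {0<..<T/2} \<Longrightarrow> m \<tau> = 0"
    and s: "\<And>i. 0 < s i" "\<And>i. s i \<le> T / 2"
    and A: "filterlim A at_top sequentially"
    and N: "\<And>t. t \<in> {0<..<T} \<Longrightarrow> N t < \<infinity>"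
    and le: "\<And>i. AE t in lborel. t \<in> {0<..<T} \<longrightarrow>
       ennreal (A i / s i) * (\<integral>\<^sup>+r. indicator {s i / 2<..<s i} r * m (t - r) \<partial>lborel) \<le> N t"
  shows "(\<integral>\<^sup>+\<tau>. m \<tau> \<partial>lborel) = 0"
proof -
  \<comment> \<open>The normalisation is by \<open>s i\<close> although the window has length
    \<open>s i / 2\<close>; this is the origin of the factor 1/2 below.\<close>
  define w where "w i t = ennreal (1 / s i) * (\<integral>\<^sup>+r. indicator {s i / 2<..<s i} r * m (t - r) \<partial>lborel)" for i t
  have [measurable]: "w i \<in> borel_measurable borel" for i unfolding w_def by measurable
  have w1: "w i t \<le> 1" for i t
  proof -
    have "w i t \<le> ennreal (1 / s i) * (\<integral>\<^sup>+r. indicator {s i / 2<..<s i} r \<partial>lborel)"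
      unfolding w_def by (intro mult_left_mono nn_integral_mono) (auto simp: indicator_def m1)
    also have "\<dots> = ennreal (1 / s i * (s i / 2))"
      using s(1)[of i] by (simp add: ennreal_mult'[symmetric])
    also have "1 / s i * (s i / 2) = 1 / 2" using s(1)[of i] by simp
    also have "ennreal (1 / 2) \<le> 1" by (simp only: ennreal_le_1)
    finally show ?thesis .
  qed
  have half: "(\<integral>\<^sup>+t. indicator {0<..<T} t * w i t \<partial>lborel) = ennreal (1 / 2) * (\<integral>\<^sup>+\<tau>. m \<tau> \<partial>lborel)" for i
  proof -
    have "(\<integral>\<^sup>+t. indicator {0<..<T} t * w i t \<partial>lborel) =
        (\<integral>\<^sup>+t. ennreal (1 / s i) * (\<integral>\<^sup>+r. indicator {s i / 2<..<s i} r * m (t - r) \<partial>lborel) \<partial>lborel)"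
    proof (rule nn_integral_cong)
      fix t
      \<comment> \<open>If \<open>r\<close> is in the window and \<open>t - r\<close> in the support
        of \<open>m\<close>, then \<open>t\<close> lies in \<open>{0<..<T}\<close> because
        \<open>s i \<le> T / 2\<close>; the cut to that interval loses nothing.\<close>
      have z0: "indicator {s i / 2<..<s i} r * m (t - r) = 0" if "t \<notin> {0<..<T}" for r
        using that msupp[of "t - r"] s(1,2)[of i] by (cases "r \<in> {s i / 2<..<s i}") auto
      have "(\<integral>\<^sup>+r. indicator {s i / 2<..<s i} r * m (t - r) \<partial>lborel) = 0" if "t \<notin> {0<..<T}"
        by (rule nn_integral_zero', rule AE_I2, rule z0[OF that])
      then show "indicator {0<..<T} t * w i t =
          ennreal (1 / s i) * (\<integral>\<^sup>+r. indicator {s i / 2<..<s i} r * m (t - r) \<partial>lborel)"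
        by (cases "t \<in> {0<..<T}") (simp_all add: w_def del: greaterThanLessThan_iff)
    qed
    also have "\<dots> = ennreal (1 / s i) * (\<integral>\<^sup>+t. (\<integral>\<^sup>+r. indicator {s i / 2<..<s i} r * m (t - r) \<partial>lborel) \<partial>lborel)"
      by (rule nn_integral_cmult) measurable
    also have "(\<integral>\<^sup>+t. (\<integral>\<^sup>+r. indicator {s i / 2<..<s i} r * m (t - r) \<partial>lborel) \<partial>lborel) =
        (\<integral>\<^sup>+r. (\<integral>\<^sup>+t. indicator {s i / 2<..<s i} r * m (t - r) \<partial>lborel) \<partial>lborel)"
      by (rule lborel_pair.Fubini'[symmetric]) measurable
    also have "\<dots> = (\<integral>\<^sup>+r. indicator {s i / 2<..<s i} r * (\<integral>\<^sup>+\<tau>. m \<tau> \<partial>lborel) \<partial>lborel)"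
      by (simp add: nn_integral_cmult lborel_nn_integral_shift)
    also have "\<dots> = ennreal (s i / 2) * (\<integral>\<^sup>+\<tau>. m \<tau> \<partial>lborel)"
      using s(1)[of i] by (simp add: nn_integral_multc)
    finally show ?thesis
      using s(1)[of i] by (simp add: mult.assoc[symmetric] ennreal_mult'[symmetric])
  qed
  \<comment> \<open>One null set serves all windows, so the limit can be taken at a fixed
    \<open>t\<close>, where the bound \<open>N t\<close> is finite and independent of
    \<open>i\<close>.\<close>
  have "AE t in lborel. \<forall>i. t \<in> {0<..<T} \<longrightarrow> ennreal (A i) * w i t \<le> N t"
    unfolding AE_all_countable
  proof
    fix i
    show "AE t in lborel. t \<in> {0<..<T} \<longrightarrow> ennreal (A i) * w i t \<le> N t"
      using le[of i]
    proof eventually_elim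
      case (elim t)
      have "ennreal (A i) * ennreal (1 / s i) = ennreal (A i / s i)"
        using s(1)[of i] by (simp flip: ennreal_mult'')
      then show ?case using elim by (simp add: w_def mult.assoc[symmetric])
    qed
  qed
  then have lim: "AE t in lborel. (\<lambda>i. indicator {0<..<T} t * w i t) \<longlonglongrightarrow> 0"
  proof eventually_elim
    case (elim t)
    show ?case
    proof (cases "t \<in> {0<..<T}")
      case True
      have "(\<lambda>i. w i t) \<longlonglongrightarrow> 0"
        using elim True by (intro tendsto_0_of_mult_le[OF N A]) (auto intro: le_less_trans[OF w1])
      then show ?thesis using True by simp
    qed simp
  qed
  \<comment> \<open>The integrals all equal half the mass of \<open>m\<close>, while the integrands
    tend to 0 below the indicator of a bounded interval.\<close>
  have "(\<lambda>i. \<integral>\<^sup>+t. indicator {0<..<T} t * w i t \<partial>lborel) \<longlonglongrightarrow> (\<integral>\<^sup>+t. 0 \<partial>(lborel :: real measure))"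
  proof (rule nn_integral_dominated_convergence[where w = "indicator {0<..<T}"])
    show "AE t in lborel. indicator {0<..<T} t * w i t \<le> indicator {0<..<T} t" for i
      by (intro AE_I2) (auto simp: indicator_def w1)
    show "(\<integral>\<^sup>+t. indicator {0<..<T} t \<partial>lborel) < \<infinity>"
      by (cases "0 \<le> T") auto
    show "AE t in lborel. (\<lambda>i. indicator {0<..<T} t * w i t) \<longlonglongrightarrow> 0" by (rule lim)
  qed measurable
  then have "ennreal (1 / 2) * (\<integral>\<^sup>+\<tau>. m \<tau> \<partial>lborel) = 0"
    unfolding half by (simp add: LIMSEQ_const_iff)
  then show ?thesis by (simp add: ennreal_eq_0_iff)
qed

text \<open>The Duhamel term is dropped and the convolution bound is applied with
  \<open>R = \<delta> / 2 * t powr \<theta>\<close>, so that \<open>2 * R\<close> is the radius on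
  which \<open>z\<close> is bounded below. The restriction to \<open>R \<le> 1\<close> comes from
  the support of the datum.\<close>

lemma solution_lower_bound:
  fixes u :: "real \<Rightarrow> 'a::euclidean_space \<Rightarrow> ennreal" and \<epsilon> :: real
  assumes sol: "integral_solution z Y f (radial_datum \<epsilon>) T u"
    and z: "\<And>t. t > 0 \<Longrightarrow> AE x in lborel. norm x \<le> \<delta> * t powr \<theta> \<longrightarrow> c * t powr (- \<gamma>) \<le> z t x"
    and pos: "c > 0" "\<delta> > 0" "\<epsilon> < DIM('a)"
  shows "AE t in lborel. AE x in lborel. t \<in> {0<..<T} \<longrightarrow> norm x \<le> \<delta> / 2 * t powr \<theta> \<longrightarrow> \<delta> / 2 * t powr \<theta> \<le> 1 \<longrightarrow>
    ennreal (unit_ball_vol DIM('a) * c * (\<delta> / 2) powr \<epsilon> * t powr (\<theta> * \<epsilon> - \<gamma>)) \<le> u t x"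
proof -
  have "AE t in lborel. AE x in lborel. t \<in> {0<..<T} \<longrightarrow>
        u t x = (\<integral>\<^sup>+y. ennreal (z t (x - y)) * ennreal (radial_datum \<epsilon> y) \<partial>lebesgue)
          + (\<integral>\<^sup>+s\<in>{0<..<t}.
               (\<integral>\<^sup>+y. ennreal (Y (t - s) (x - y)) * ennreal (f (enn2real (u s y))) \<partial>lebesgue)
             \<partial>lebesgue)"
    using sol by (intro AE_lebesgue_on_Times) (auto simp: integral_solution_def)
  then show ?thesis
  proof eventually_elim
    case (elim t)
    then show ?case
    proof eventually_elim
      case (elim x)
      show ?case
      proof (intro impI)
        let ?R = "\<delta> / 2 * t powr \<theta>"
        assume t: "t \<in> {0<..<T}" and x: "norm x \<le> ?R" and R: "?R \<le> 1"
        have "ennreal (unit_ball_vol DIM('a) * (c * t powr (- \<gamma>)) * ?R powr \<epsilon>) \<le>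
            (\<integral>\<^sup>+y. ennreal (z t (x - y)) * ennreal (radial_datum \<epsilon> y) \<partial>lebesgue)"
          using z[of t] t pos x R by (intro convolution_radial_datum_ge) auto
        also have "\<dots> \<le> u t x" using elim t by simp
        also have "unit_ball_vol DIM('a) * (c * t powr (- \<gamma>)) * ?R powr \<epsilon> =
            unit_ball_vol DIM('a) * c * (\<delta> / 2) powr \<epsilon> * (t powr (\<theta> * \<epsilon>) * t powr (- \<gamma>))"
          using t pos powr_mult[of "\<delta> / 2" "t powr \<theta>" \<epsilon>] by (simp only: powr_powr mult_ac)
        also have "t powr (\<theta> * \<epsilon>) * t powr (- \<gamma>) = t powr (\<theta> * \<epsilon> - \<gamma>)"
          by (simp flip: powr_add)
        finally show "ennreal (unit_ball_vol DIM('a) * c * (\<delta> / 2) powr \<epsilon> * t powr (\<theta> * \<epsilon> - \<gamma>)) \<le> u t x" .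
      qed
    qed
  qed
qed

section \<open>Choice of exponents and windows, and the contradiction\<close>

theorem lemma2p2:
  fixes \<alpha> \<beta> k :: real
    and \<nu> :: "'a::euclidean_space measure"
    and Ga :: "real \<Rightarrow> real \<Rightarrow> real"
    and Y :: "real \<Rightarrow> 'a \<Rightarrow> real"
    and f :: "real \<Rightarrow> real"
  assumes "0 < \<alpha>" "\<alpha> < 1" "0 < \<beta>" "\<beta> < 2"
    and "spectral_measure \<beta> \<nu>"
    and "stable_density \<alpha> Ga"
    and "solves_Y_equation \<alpha> (Z \<alpha> \<beta> \<nu> Ga) Y"
    and "\<forall>s\<ge>0. \<exists>r>0. \<exists>L. L-lipschitz_on (cball s r \<inter> {0..}) f"
    and "mono_on {0..} f"
    and "f 0 = 0" "\<forall>s>0. 0 < f s"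
    and "k > 1 + \<beta> / (\<alpha> * DIM('a))"
    and "osgood_type k f"
  shows "\<exists>u0 :: 'a \<Rightarrow> real. (\<forall>x. 0 \<le> u0 x) \<and> integrable lebesgue u0 \<and>
    \<not> (\<exists>T>0. \<exists>u :: real \<Rightarrow> 'a \<Rightarrow> ennreal.
         integral_solution (Z \<alpha> \<beta> \<nu> Ga) Y f u0 T u \<and> (\<forall>t\<in>{0<..<T}. u t \<in> L1))"
proof -
  interpret stable_symbol \<beta> \<nu> using assms by unfold_locales
  let ?d = "real DIM('a)" and ?V = "unit_ball_vol (real DIM('a))"
  define \<theta> where "\<theta> = \<alpha> / \<beta>"
  define \<gamma> where "\<gamma> = \<alpha> * ?d / \<beta>"
  have \<theta>: "\<theta> > 0" and \<gamma>: "\<gamma> > 0" and \<gamma>\<theta>: "\<gamma> = \<theta> * ?d"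
    using assms by (simp_all add: \<theta>_def \<gamma>_def)
  have V: "?V > 0" by simp
  obtain c \<delta> where c: "c > 0" and \<delta>: "\<delta> > 0" and z:
    "\<And>t. t > 0 \<Longrightarrow> AE x in lborel. norm x \<le> \<delta> * t powr \<theta> \<longrightarrow> c * t powr (- \<gamma>) \<le> Z \<alpha> \<beta> \<nu> Ga t x"
    using Z_lower_bound[OF assms(1,6)] unfolding \<theta>_def \<gamma>_def by blast
  have k1: "k > 1 + 1 / \<gamma>" using assms(12) by (simp add: \<gamma>_def)
  moreover have "0 < 1 + 1 / \<gamma>" using \<gamma> by (intro add_pos_pos) auto
  ultimately have k0: "k > 0" by linarith
  have k: "k > 0" "(\<gamma> + 1) / k < \<gamma>"
    using k0 k1 \<gamma> by (simp_all add: field_simps)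
  obtain q where q: "(\<gamma> + 1) / k < q" "q < \<gamma>" using dense[OF k(2)] by blast
  have "0 < (\<gamma> + 1) / k" using \<gamma> k(1) by simp
  then have q0: "q > 0" using q(1) by (rule less_trans)
  have kq: "k - (\<gamma> + 1) / q > 0" using q(1) q0 k(1) by (simp add: field_simps)
  \<comment> \<open>Chosen so that the lower bound for a solution grows exactly like
    \<open>t powr (- q)\<close> as \<open>t\<close> tends to 0; \<open>q < \<gamma>\<close> gives
    \<epsilon> > 0, and \<open>q > 0\<close> gives \<open>\<epsilon> < ?d\<close>.\<close>
  define \<epsilon> where "\<epsilon> = (\<gamma> - q) / \<theta>"
  have \<epsilon>: "0 < \<epsilon>" "\<epsilon> < ?d" "\<theta> * \<epsilon> - \<gamma> = - q"
    using q q0 \<theta> by (simp_all add: \<epsilon>_def \<gamma>\<theta> field_simps)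
  obtain c1 \<phi>0 where c1: "c1 > 0" and \<phi>0: "\<And>i::nat. 0 < \<phi>0 i" "\<And>i. c1 * \<phi>0 i powr k \<le> f (\<phi>0 i)"
    and \<phi>0_lim: "filterlim \<phi>0 at_top sequentially"
    using osgood_type_large_values[OF assms(13)] by blast
  have Ym: "case_prod Y \<in> borel_measurable (borel \<Otimes>\<^sub>M borel)"
    using assms(7) by (simp add: solves_Y_equation_def borel_prod)
  note [measurable (raw)] = measurable_uncurry[OF Ym]
  have False if T: "T > 0" and sol: "integral_solution (Z \<alpha> \<beta> \<nu> Ga) Y f (radial_datum \<epsilon>) T u"
    and L1: "\<forall>t\<in>{0<..<T}. u t \<in> L1" for T and u :: "real \<Rightarrow> 'a \<Rightarrow> ennreal"
  proof -
    define C where "C = ?V * c * (\<delta> / 2) powr \<epsilon>"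
    have C: "C > 0" using V c \<delta> by (simp add: C_def)
    have low: "AE t in lborel. AE x in lborel. t \<in> {0<..<T} \<longrightarrow> norm x \<le> \<delta> / 2 * t powr \<theta> \<longrightarrow>
        \<delta> / 2 * t powr \<theta> \<le> 1 \<longrightarrow> ennreal (C * t powr (- q)) \<le> u t x"
      using solution_lower_bound[OF sol z c \<delta> \<epsilon>(2)] by (simp only: C_def \<epsilon>(3))
    have "(\<lambda>i. (C / \<phi>0 i) powr (1 / q)) \<longlonglongrightarrow> 0"
      using q0 C \<phi>0(1)
      by (intro tendsto_zero_powrI[OF real_tendsto_divide_at_top[OF tendsto_const \<phi>0_lim] tendsto_const])
        (auto intro!: always_eventually less_imp_le)
    \<comment> \<open>Discarding finitely many indices puts every window into the first half of the
      time interval and keeps the radii within the support of the datum.\<close>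
    then have ev: "\<forall>\<^sub>F i in sequentially. (C / \<phi>0 i) powr (1 / q) < min (T / 2) ((2 / \<delta>) powr (1 / \<theta>))"
      using T \<delta> by (intro order_tendstoD(2)) auto
    then obtain n where n: "\<And>i. i \<ge> n \<Longrightarrow> (C / \<phi>0 i) powr (1 / q) < min (T / 2) ((2 / \<delta>) powr (1 / \<theta>))"
      by (auto simp: eventually_sequentially)
    define \<phi> where "\<phi> i = \<phi>0 (i + n)" for i
    \<comment> \<open>The last time at which the lower bound \<open>C * t powr (- q)\<close> is
      still at least \<open>\<phi> i\<close>.\<close>
    define s where "s i = (C / \<phi> i) powr (1 / q)" for i
    \<comment> \<open>The radius at the left end \<open>s i / 2\<close>, where the region of the
      lower bound is smallest over the window.\<close>
    define \<rho> where "\<rho> i = \<delta> / 2 * (s i / 2) powr \<theta>" for i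
    \<comment> \<open>The factor of the cylinder bound times \<open>s i\<close>, which compensates
      the division by \<open>s i\<close> in the window averages.\<close>
    define A where "A i = f (\<phi> i) * ?V * \<rho> i ^ DIM('a) * s i" for i
    have \<phi>: "\<phi> i > 0" "c1 * \<phi> i powr k \<le> f (\<phi> i)" for i
      using \<phi>0 by (simp_all add: \<phi>_def)
    have fpos: "f (\<phi> i) \<ge> 0" for i using \<phi>[of i] assms(11) by (simp add: less_imp_le)
    have \<phi>_lim: "filterlim \<phi> at_top sequentially"
      unfolding \<phi>_def by (rule filterlim_compose[OF \<phi>0_lim filterlim_add_const_nat_at_top])
    have s0: "s i > 0" for i using C \<phi>(1)[of i] by (simp add: s_def)
    have sT: "s i \<le> T / 2" and s\<delta>: "\<delta> / 2 * s i powr \<theta> \<le> 1" for i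
    proof -
      have "s i < min (T / 2) ((2 / \<delta>) powr (1 / \<theta>))" using n[of "i + n"] by (simp add: s_def \<phi>_def)
      then show "s i \<le> T / 2" by simp
      have "s i \<le> (2 / \<delta>) powr (1 / \<theta>)" using \<open>s i < _\<close> by simp
      then have "s i powr \<theta> \<le> ((2 / \<delta>) powr (1 / \<theta>)) powr \<theta>"
        using s0[of i] \<theta> by (intro powr_mono2) auto
      then show "\<delta> / 2 * s i powr \<theta> \<le> 1" using \<delta> \<theta> by (simp add: powr_powr field_simps)
    qed
    have sq: "C * s i powr (- q) = \<phi> i" for i
    proof -
      have "s i powr q = C / \<phi> i" using C \<phi>(1)[of i] q0 by (simp add: s_def powr_powr)
      then show ?thesis using C \<phi>(1)[of i] by (simp add: powr_minus_divide)
    qed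
    \<comment> \<open>Both cuts only decrease the mass of the positive part of \<open>Y\<close>, so
      the cylinder bound survives; they provide the boundedness and the support that the window
      argument asks for.\<close>
    define m where "m \<tau> = indicator {0<..<T/2} \<tau> * min 1 (\<integral>\<^sup>+x. ennreal (Y \<tau> x) \<partial>lborel)" for \<tau>
    have "(\<integral>\<^sup>+\<tau>. m \<tau> \<partial>lborel) = 0"
    proof (rule no_mass_windows[where s = s and A = A and N = "\<lambda>t. \<integral>\<^sup>+x. u t x \<partial>lebesgue"])
      show "m \<in> borel_measurable borel" unfolding m_def by measurable
      show "m \<tau> \<le> 1" for \<tau> by (auto simp: m_def indicator_def)
      show "m \<tau> = 0" if "\<tau> \<notin> {0<..<T/2}" for \<tau> using that by (simp add: m_def)
      show "0 < s i" "s i \<le> T / 2" for i by (fact s0, fact sT)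
      show "(\<integral>\<^sup>+x. u t x \<partial>lebesgue) < \<infinity>" if "t \<in> {0<..<T}" for t
        using L1 that by (auto simp: L1_def)
      show "filterlim A at_top sequentially"
      proof (rule filterlim_at_top_mono)
        \<comment> \<open>Collects the constants: \<open>\<rho> i ^ DIM('a) * s i\<close> is a
          multiple of \<open>s i powr (\<gamma> + 1)\<close>, hence of
          \<open>\<phi> i powr (- ((\<gamma> + 1) / q))\<close>.\<close>
        let ?K = "c1 * ?V * (\<delta> / 2) powr ?d * (1 / 2) powr \<gamma> * C powr ((\<gamma> + 1) / q)"
        have "filterlim (\<lambda>i. \<phi> i powr (k - (\<gamma> + 1) / q)) at_top sequentially"
          by (rule filterlim_compose[OF filterlim_powr_at_top[OF kq] \<phi>_lim])
        then show "filterlim (\<lambda>i. ?K * \<phi> i powr (k - (\<gamma> + 1) / q)) at_top sequentially"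
          using c1 V \<delta> C by (intro filterlim_tendsto_pos_mult_at_top[OF tendsto_const]) auto
        have "?K * \<phi> i powr (k - (\<gamma> + 1) / q) \<le> A i" for i
        proof -
          have "\<rho> i ^ DIM('a) = (\<delta> / 2) powr ?d * ((1 / 2) powr \<gamma> * s i powr \<gamma>)"
          proof -
            have "\<rho> i > 0" using \<delta> s0[of i] by (simp add: \<rho>_def)
            then have "\<rho> i ^ DIM('a) = \<rho> i powr ?d" by (simp add: powr_realpow)
            also have "\<dots> = (\<delta> / 2) powr ?d * ((s i / 2) powr \<theta>) powr ?d"
              unfolding \<rho>_def using \<delta> by (subst powr_mult) auto
            also have "((s i / 2) powr \<theta>) powr ?d = (s i / 2) powr \<gamma>"
              by (simp only: powr_powr \<gamma>\<theta>)
            also have "(s i / 2) powr \<gamma> = (1 / 2) powr \<gamma> * s i powr \<gamma>"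
              using s0[of i] powr_mult[of "1/2" "s i" \<gamma>] by simp
            finally show ?thesis .
          qed
          moreover have "s i powr \<gamma> * s i = s i powr (\<gamma> + 1)"
            using s0[of i] by (simp add: powr_add)
          moreover have "s i powr (\<gamma> + 1) = C powr ((\<gamma> + 1) / q) * \<phi> i powr (- ((\<gamma> + 1) / q))"
          proof -
            have "s i powr (\<gamma> + 1) = (C / \<phi> i) powr ((\<gamma> + 1) / q)" by (simp add: s_def powr_powr)
            also have "\<dots> = C powr ((\<gamma> + 1) / q) / \<phi> i powr ((\<gamma> + 1) / q)"
              by (rule powr_divide)
            finally show ?thesis by (simp add: powr_minus_divide)
          qed
          ultimately have "A i = f (\<phi> i) * (?V * (\<delta> / 2) powr ?d * (1 / 2) powr \<gamma> *
              (C powr ((\<gamma> + 1) / q) * \<phi> i powr (- ((\<gamma> + 1) / q))))"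
            unfolding A_def by (simp add: mult.assoc)
          moreover have "f (\<phi> i) * (?V * (\<delta> / 2) powr ?d * (1 / 2) powr \<gamma> *
              (C powr ((\<gamma> + 1) / q) * \<phi> i powr (- ((\<gamma> + 1) / q)))) \<ge> (c1 * \<phi> i powr k) * (?V * (\<delta> / 2) powr ?d * (1 / 2) powr \<gamma> *
              (C powr ((\<gamma> + 1) / q) * \<phi> i powr (- ((\<gamma> + 1) / q))))"
            using V by (intro mult_right_mono \<phi>(2) mult_nonneg_nonneg) auto
          moreover have "\<phi> i powr (k - (\<gamma> + 1) / q) = \<phi> i powr k * \<phi> i powr (- ((\<gamma> + 1) / q))"
            by (simp flip: powr_add)
          ultimately show ?thesis by (simp only: mult_ac)
        qed
        then show "\<forall>\<^sub>F i in sequentially. ?K * \<phi> i powr (k - (\<gamma> + 1) / q) \<le> A i"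
          by (intro always_eventually allI)
      qed
      show "AE t in lborel. t \<in> {0<..<T} \<longrightarrow>
          ennreal (A i / s i) * (\<integral>\<^sup>+r. indicator {s i / 2<..<s i} r * m (t - r) \<partial>lborel) \<le> (\<integral>\<^sup>+x. u t x \<partial>lebesgue)" for i
      proof -
        have "AE t in lborel. AE x in lborel. t \<in> {0<..<T} \<longrightarrow> t \<in> {s i / 2<..<s i} \<longrightarrow> x \<in> ball 0 (\<rho> i) \<longrightarrow>
            ennreal (\<phi> i) \<le> u t x"
          using low
        proof eventually_elim
          case (elim t)
          then show ?case
          proof eventually_elim
            case (elim x)
            show ?case
            proof (intro impI)
              assume t: "t \<in> {0<..<T}" "t \<in> {s i / 2<..<s i}" and x: "x \<in> ball 0 (\<rho> i)"
              have "\<rho> i \<le> \<delta> / 2 * t powr \<theta>"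
                unfolding \<rho>_def using t \<delta> \<theta> s0[of i] by (intro mult_left_mono powr_mono2) auto
              then have "norm x \<le> \<delta> / 2 * t powr \<theta>" using x by simp
              moreover have "\<delta> / 2 * t powr \<theta> \<le> \<delta> / 2 * s i powr \<theta>"
                using t \<delta> \<theta> by (intro mult_left_mono powr_mono2) auto
              then have "\<delta> / 2 * t powr \<theta> \<le> 1" using s\<delta>[of i] by linarith
              ultimately have "ennreal (C * t powr (- q)) \<le> u t x" using elim t by simp
              moreover have "\<phi> i \<le> C * t powr (- q)"
                unfolding sq[of i, symmetric] using t C q0 by (intro mult_left_mono powr_mono2') auto
              ultimately show "ennreal (\<phi> i) \<le> u t x" using ennreal_leI order_trans by blast
            qed
          qed
        qed
        from mass_ge_of_cylinder[OF sol Ym assms(9) fpos less_imp_le[OF \<phi>(1)] _ _ this]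
        have "AE t in lborel. t \<in> {0<..<T} \<longrightarrow> ennreal (f (\<phi> i) * ?V * \<rho> i ^ DIM('a)) *
          (\<integral>\<^sup>+r. indicator {s i / 2<..<s i} r * (indicator {0<..} (t - r) * (\<integral>\<^sup>+x. ennreal (Y (t - r) x) \<partial>lborel)) \<partial>lborel)
          \<le> (\<integral>\<^sup>+x. u t x \<partial>lebesgue)"
          using s0[of i] \<delta> by (simp add: \<rho>_def)
        then show ?thesis
        proof eventually_elim
          case (elim t)
          have le: "(\<integral>\<^sup>+r. indicator {s i / 2<..<s i} r * m (t - r) \<partial>lborel) \<le>
            (\<integral>\<^sup>+r. indicator {s i / 2<..<s i} r * (indicator {0<..} (t - r) * (\<integral>\<^sup>+x. ennreal (Y (t - r) x) \<partial>lborel)) \<partial>lborel)"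
            by (intro nn_integral_mono mult_left_mono) (auto simp: m_def indicator_def)
          have "A i / s i = f (\<phi> i) * ?V * \<rho> i ^ DIM('a)" using s0[of i] by (simp add: A_def)
          with elim show ?case
            using order_trans[OF mult_left_mono[OF le zero_le]] by (simp only: simp_thms) blast
        qed
      qed
    qed
    moreover have "(\<integral>\<^sup>+\<tau>. m \<tau> \<partial>lborel) > 0"
      unfolding m_def
    proof (rule positive_part_mass_of_Y[OF assms(2,7)])
      \<comment> \<open>Any time in the support range of \<open>m\<close> would do; at it
        \<open>Z\<close> has a positive lower bound on a ball.\<close>
      show "0 < T / 4" "T / 4 \<le> T / 2" "0 < \<delta> * (T / 4) powr \<theta>" using T \<delta> by simp_all
      show "AE x in lborel. norm x \<le> \<delta> * (T / 4) powr \<theta> \<longrightarrow> 0 < Z \<alpha> \<beta> \<nu> Ga (T / 4) x"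
        using z[OF \<open>0 < T / 4\<close>]
      proof eventually_elim
        case (elim x)
        have "0 < c * (T / 4) powr (- \<gamma>)" using c T by simp
        then show ?case using elim by (auto intro: less_le_trans)
      qed
    qed
    ultimately show False by simp
  qed
  then show ?thesis
    by (intro exI[of _ "radial_datum \<epsilon>"] conjI allI radial_datum_nonneg integrable_radial_datum \<epsilon>) blast
qed

end
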